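(* Let $1\leq q<\infty$ and let $\lambda,\mu,\nu,\alpha,\beta$ be real numbers. Then $H_{\lambda,\mu,\nu}$ is bounded from $L^q_\alpha$ to $L^q_\beta$ if and only if $$\lambda=\mu+\nu+1+\frac{\beta-\alpha}{q}\quad\text{and}\quad -q\nu<\beta+1<q(\lambda-\nu),$$ or equivalently, if and only if $$\lambda=\mu+\nu+1+\frac{\beta-\alpha}{q}\quad\text{and}\quad q(\mu+1-\lambda)<\alpha+1<q(\mu+1).$$ Moreover, when $H_{\lambda,\mu,\nu}$ is bounded from $L^q_\alpha$ to $L^q_\beta$, its norm $\|H_{\lambda,\mu,\nu}\|_{L^q_\alpha\to L^q_\beta}=\sup_{0\neq f\in L^q_\alpha}\frac{\|H_{\lambda,\mu,\nu}f\|_{q,\beta}}{\|f\|_{q,\alpha}}$ is given by $$\|H_{\lambda,\mu,\nu}\|_{L^q_\alpha\to L^q_\beta}=(1-p^{-1})\left[1+\frac{1}{p^{\mu+1-\frac1q(\alpha+1)}-1}+\frac{1}{p^{\nu+\frac1q(\beta+1)}-1}\right].$$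
   Context: Let $p$ be a prime, $\mathbb{Q}_p$ the field of $p$-adic numbers with its norm $|\cdot|_p$ (so $|p|_p=p^{-1}$), $\mathbb{Q}_p^*=\mathbb{Q}_p\setminus\{0\}$, and $dx$ the Haar measure on $\mathbb{Q}_p$ normalized so that $\{x:|x|_p\leq 1\}$ has measure $1$. For $1\leq q<\infty$ and $\theta\in\mathbb{R}$, $L^q_\theta$ is the space of real-valued measurable functions $f$ on $\mathbb{Q}_p^*$ with $\|f\|_{q,\theta}=\left[\int_{\mathbb{Q}_p^*}|f(x)|^q|x|_p^\theta\,dx\right]^{1/q}<\infty$. For real $\lambda,\mu,\nu$ and a real-valued measurable $f$ on $\mathbb{Q}_p^*$, $$H_{\lambda,\mu,\nu}f(y)=\int_{\mathbb{Q}_p^*}\frac{|x|_p^\mu|y|_p^\nu}{[\max\{|x|_p,|y|_p\}]^\lambda}f(x)\,dx,\qquad y\in\mathbb{Q}_p^*.$$ "Bounded from $X$ to $Y$" means that for every $f\in X$ the integral converges absolutely for almost every $y$ and there is a constant $C$ with $\|H_{\lambda,\mu,\nu}f\|_Y\leq C\|f\|_X$ for all $f\in X$. *)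

theory Defs
  imports "HOL-Analysis.Analysis" "Berlekamp_Zassenhaus.Finite_Field"
begin

section \<open>The \<open>p\<close>-adic absolute value on the rationals\<close>

definition padic_val :: "nat \<Rightarrow> rat \<Rightarrow> int" where
  "padic_val p r =
     int (multiplicity (int p) (fst (quotient_of r))) - int (multiplicity (int p) (snd (quotient_of r)))"

definition padic_abs :: "nat \<Rightarrow> rat \<Rightarrow> real" where
  "padic_abs p r = (if r = 0 then 0 else real p powi (- padic_val p r))"

lemma padic_abs_0 [simp]: "padic_abs p 0 = 0"
  by (simp add: padic_abs_def)

lemma padic_abs_1 [simp]: "padic_abs p 1 = 1"
  by (simp add: padic_abs_def padic_val_def)

context
  fixes p :: nat
  assumes prime: "prime p"
begin

private lemma p_gt_1: "real p > 1"
  using prime_gt_1_nat[OF prime] by simp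

private lemma prime_elem_p: "prime_elem (int p)"
  using prime by auto

lemma padic_abs_nonneg: "padic_abs p r \<ge> 0"
  using p_gt_1 by (simp add: padic_abs_def)

lemma padic_abs_eq_0_iff: "padic_abs p r = 0 \<longleftrightarrow> r = 0"
  using p_gt_1 by (simp add: padic_abs_def)

lemma padic_abs_minus: "padic_abs p (- r) = padic_abs p r"
proof -
  have "multiplicity (int p) (- a) = multiplicity (int p) a" for a
    using multiplicity_normalize_right[of "int p" "- a"] multiplicity_normalize_right[of "int p" a]
    by (simp del: multiplicity_normalize_right)
  then show ?thesis
    by (cases "quotient_of r") (simp add: padic_abs_def padic_val_def rat_uminus_code)
qed

lemma padic_abs_minus_commute: "padic_abs p (r - s) = padic_abs p (s - r)"
  using padic_abs_minus[of "r - s"] by simp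

lemma padic_abs_fraction:
  assumes "a \<noteq> 0" "b \<noteq> 0"
  shows "padic_abs p (of_int a / of_int b) =
           real p powi (int (multiplicity (int p) b) - int (multiplicity (int p) a))"
proof -
  obtain c d where cd: "quotient_of (of_int a / of_int b :: rat) = (c, d)"
    by (cases "quotient_of (of_int a / of_int b :: rat)")
  have d: "d > 0"
    using quotient_of_denom_pos[OF cd] .
  have eq: "(of_int a / of_int b :: rat) = of_int c / of_int d"
    using quotient_of_div[OF cd] .
  have c: "c \<noteq> 0"
    using eq assms d by auto
  have "(of_int (a * d) :: rat) = of_int (c * b)"
    using eq assms d by (simp add: field_simps)
  then have *: "a * d = c * b"
    by (simp only: of_int_eq_iff)
  have "multiplicity (int p) a + multiplicity (int p) d = multiplicity (int p) c + multiplicity (int p) b"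
    using arg_cong[OF *, of "multiplicity (int p)"] assms c d
    by (simp add: prime_elem_multiplicity_mult_distrib[OF prime_elem_p])
  then have "- (int (multiplicity (int p) c) - int (multiplicity (int p) d))
      = int (multiplicity (int p) b) - int (multiplicity (int p) a)"
    by simp
  then show ?thesis
    using assms by (simp add: padic_abs_def padic_val_def cd)
qed

private lemma rat_fraction:
  fixes r :: rat
  obtains a b where "r = of_int a / of_int b" "b \<noteq> 0"
proof -
  obtain c d where cd: "quotient_of r = (c, d)"
    by (cases "quotient_of r")
  show thesis
    using that[of c d] quotient_of_div[OF cd] quotient_of_denom_pos[OF cd] by simp
qed

lemma padic_abs_mult: "padic_abs p (r * s) = padic_abs p r * padic_abs p s"
proof (cases "r = 0 \<or> s = 0")
  case False
  obtain a b where r: "r = of_int a / of_int b" "b \<noteq> 0" by (rule rat_fraction)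
  obtain c d where s: "s = of_int c / of_int d" "d \<noteq> 0" by (rule rat_fraction)
  have nz: "a \<noteq> 0" "c \<noteq> 0"
    using False r s by auto
  have rs: "r * s = of_int (a * c) / of_int (b * d)"
    using r s by simp
  show ?thesis
    unfolding rs using r(2) s(2) nz p_gt_1
    by (subst padic_abs_fraction)
       (simp_all add: r(1) s(1) padic_abs_fraction power_int_add [symmetric] add_diff_add
          prime_elem_multiplicity_mult_distrib[OF prime_elem_p])
qed auto

lemma padic_abs_inverse: "padic_abs p (inverse r) = inverse (padic_abs p r)"
proof (cases "r = 0")
  case False
  then have "padic_abs p r * padic_abs p (inverse r) = 1"
    by (simp flip: padic_abs_mult)
  then show ?thesis
    by (metis inverse_unique)
qed simp

lemma padic_abs_ultrametric: "padic_abs p (r + s) \<le> max (padic_abs p r) (padic_abs p s)"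
proof (cases "r = 0 \<or> s = 0 \<or> r + s = 0")
  case True
  then show ?thesis
    using padic_abs_nonneg[of r] padic_abs_nonneg[of s] by auto
next
  case False
  obtain a b where r: "r = of_int a / of_int b" "b \<noteq> 0" by (rule rat_fraction)
  obtain c d where s: "s = of_int c / of_int d" "d \<noteq> 0" by (rule rat_fraction)
  define x where "x = a * d"
  define y where "y = c * b"
  define e where "e = b * d"
  have e: "e \<noteq> 0"
    using r s by (simp add: e_def)
  have r': "r = of_int x / of_int e" and s': "s = of_int y / of_int e"
    using r s by (simp_all add: x_def y_def e_def)
  have rs': "r + s = of_int (x + y) / of_int e"
    by (simp add: r' s' add_divide_distrib)
  have nz: "x \<noteq> 0" "y \<noteq> 0" "x + y \<noteq> 0"
    using False r' s' rs' by auto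
  define m where "m = min (multiplicity (int p) x) (multiplicity (int p) y)"
  have "int p ^ m dvd x + y"
    by (intro dvd_add) (auto simp: m_def intro: multiplicity_dvd')
  then have "m \<le> multiplicity (int p) (x + y)"
    using nz prime_elem_p by (intro multiplicity_geI) (auto simp: prime_elem_def)
  then have "real p powi (int (multiplicity (int p) e) - int (multiplicity (int p) (x + y)))
      \<le> real p powi (int (multiplicity (int p) e) - int m)"
    using p_gt_1 by (intro power_int_increasing) auto
  then have "padic_abs p (r + s) \<le> real p powi (int (multiplicity (int p) e) - int m)"
    unfolding rs' using nz e by (simp only: padic_abs_fraction not_False_eq_True)
  also have "\<dots> \<le> max (padic_abs p r) (padic_abs p s)"
    unfolding r' s' using nz e by (simp add: padic_abs_fraction m_def min_def)
  finally show ?thesis .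
qed

lemma padic_abs_triangle: "padic_abs p (r + s) \<le> padic_abs p r + padic_abs p s"
  using padic_abs_ultrametric[of r s] padic_abs_nonneg[of r] padic_abs_nonneg[of s] by simp

lemma padic_abs_diff_abs: "\<bar>padic_abs p r - padic_abs p s\<bar> \<le> padic_abs p (r - s)"
  using padic_abs_triangle[of "r - s" s] padic_abs_triangle[of "s - r" r]
    padic_abs_minus_commute[of r s] by simp

end


section \<open>The field \<open>\<rat>\<^sub>p\<close> as the completion of the rationals\<close>

definition padic_Cauchy :: "nat \<Rightarrow> (nat \<Rightarrow> rat) \<Rightarrow> bool" where
  "padic_Cauchy p X \<longleftrightarrow> (\<forall>e>0. \<exists>N. \<forall>m\<ge>N. \<forall>n\<ge>N. padic_abs p (X m - X n) < e)"

definition padic_null :: "nat \<Rightarrow> (nat \<Rightarrow> rat) \<Rightarrow> bool" where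
  "padic_null p X \<longleftrightarrow> (\<lambda>n. padic_abs p (X n)) \<longlonglongrightarrow> 0"

lemma padic_Cauchy_const [simp]: "padic_Cauchy p (\<lambda>_. c)"
  by (simp add: padic_Cauchy_def)

lemma padic_null_0 [simp]: "padic_null p (\<lambda>_. 0)"
  by (simp add: padic_null_def)

lemma not_padic_null_1 [simp]: "\<not> padic_null p (\<lambda>_. 1)"
  by (simp add: padic_null_def LIMSEQ_const_iff)

context
  fixes p :: nat
  assumes prime: "prime p"
begin

lemma padic_Cauchy_abs_Cauchy:
  assumes "padic_Cauchy p X"
  shows "Cauchy (\<lambda>n. padic_abs p (X n))"
proof (rule metric_CauchyI)
  fix e :: real assume "e > 0"
  then obtain N where "\<And>m n. m \<ge> N \<Longrightarrow> n \<ge> N \<Longrightarrow> padic_abs p (X m - X n) < e"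
    using assms unfolding padic_Cauchy_def by blast
  then show "\<exists>N. \<forall>m\<ge>N. \<forall>n\<ge>N. dist (padic_abs p (X m)) (padic_abs p (X n)) < e"
    unfolding dist_real_def by (blast intro: le_less_trans[OF padic_abs_diff_abs[OF prime]])
qed

lemma padic_Cauchy_abs_convergent:
  assumes "padic_Cauchy p X"
  shows "(\<lambda>n. padic_abs p (X n)) \<longlonglongrightarrow> lim (\<lambda>n. padic_abs p (X n))"
  using padic_Cauchy_abs_Cauchy[OF assms] by (simp only: Cauchy_convergent_iff convergent_LIMSEQ_iff)

lemma padic_Cauchy_bounded:
  assumes "padic_Cauchy p X"
  obtains B where "B > 0" "\<And>n. padic_abs p (X n) \<le> B"
proof -
  have "Bseq (\<lambda>n. padic_abs p (X n))"
    using Cauchy_convergent_iff convergent_imp_Bseq padic_Cauchy_abs_Cauchy[OF assms] by blast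
  then obtain B where "B > 0" "\<And>n. \<bar>padic_abs p (X n)\<bar> \<le> B"
    by (auto simp: Bseq_def)
  then show thesis
    using that by (meson abs_le_D1)
qed

lemma padic_null_minus: "padic_null p X \<Longrightarrow> padic_null p (\<lambda>n. - X n)"
  by (simp add: padic_null_def padic_abs_minus[OF prime])

lemma padic_null_diff_commute: "padic_null p (\<lambda>n. X n - Y n) \<longleftrightarrow> padic_null p (\<lambda>n. Y n - X n)"
  by (simp add: padic_null_def padic_abs_minus_commute[OF prime])

lemma padic_null_bound:
  assumes "g \<longlonglongrightarrow> 0" "\<And>n. padic_abs p (X n) \<le> g n"
  shows "padic_null p X"
  unfolding padic_null_def
  by (rule tendsto_sandwich[OF _ _ tendsto_const assms(1)])
     (simp_all add: assms(2) padic_abs_nonneg[OF prime])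

lemma padic_null_add:
  assumes "padic_null p X" "padic_null p Y"
  shows "padic_null p (\<lambda>n. X n + Y n)"
  using tendsto_add[OF assms[unfolded padic_null_def]]
  by (intro padic_null_bound[where g = "\<lambda>n. padic_abs p (X n) + padic_abs p (Y n)"])
     (simp_all add: padic_abs_triangle[OF prime])

lemma padic_null_mult:
  assumes "padic_Cauchy p X" "padic_null p Y"
  shows "padic_null p (\<lambda>n. X n * Y n)"
proof -
  obtain B where "B > 0" "\<And>n. padic_abs p (X n) \<le> B"
    using padic_Cauchy_bounded[OF assms(1)] by blast
  then show ?thesis
    using tendsto_mult_right_zero[OF assms(2)[unfolded padic_null_def], of B]
    by (intro padic_null_bound[where g = "\<lambda>n. B * padic_abs p (Y n)"])
       (simp_all add: padic_abs_mult[OF prime] mult_right_mono padic_abs_nonneg[OF prime])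
qed

lemma padic_Cauchy_add:
  assumes "padic_Cauchy p X" "padic_Cauchy p Y"
  shows "padic_Cauchy p (\<lambda>n. X n + Y n)"
  unfolding padic_Cauchy_def
proof (intro allI impI)
  fix e :: real assume "e > 0"
  then obtain M N where
    M: "\<And>m n. m \<ge> M \<Longrightarrow> n \<ge> M \<Longrightarrow> padic_abs p (X m - X n) < e" and
    N: "\<And>m n. m \<ge> N \<Longrightarrow> n \<ge> N \<Longrightarrow> padic_abs p (Y m - Y n) < e"
    using assms unfolding padic_Cauchy_def by meson
  have "padic_abs p (X m + Y m - (X n + Y n)) < e" if "m \<ge> max M N" "n \<ge> max M N" for m n
    using padic_abs_ultrametric[OF prime, of "X m - X n" "Y m - Y n"] M[of m n] N[of m n] that
    by (simp add: add_diff_add)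
  then show "\<exists>N. \<forall>m\<ge>N. \<forall>n\<ge>N. padic_abs p (X m + Y m - (X n + Y n)) < e"
    by blast
qed

lemma padic_Cauchy_minus: "padic_Cauchy p X \<Longrightarrow> padic_Cauchy p (\<lambda>n. - X n)"
  unfolding padic_Cauchy_def minus_diff_minus padic_abs_minus[OF prime] .

lemma padic_Cauchy_diff:
  "padic_Cauchy p X \<Longrightarrow> padic_Cauchy p Y \<Longrightarrow> padic_Cauchy p (\<lambda>n. X n - Y n)"
  using padic_Cauchy_add[of X "\<lambda>n. - Y n"] padic_Cauchy_minus by simp

lemma padic_Cauchy_mult:
  assumes "padic_Cauchy p X" "padic_Cauchy p Y"
  shows "padic_Cauchy p (\<lambda>n. X n * Y n)"
  unfolding padic_Cauchy_def
proof (intro allI impI)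
  fix e :: real assume e: "e > 0"
  obtain B where B: "B > 0" "\<And>n. padic_abs p (X n) \<le> B"
    using padic_Cauchy_bounded[OF assms(1)] by blast
  obtain C where C: "C > 0" "\<And>n. padic_abs p (Y n) \<le> C"
    using padic_Cauchy_bounded[OF assms(2)] by blast
  obtain M N where
    M: "\<And>m n. m \<ge> M \<Longrightarrow> n \<ge> M \<Longrightarrow> padic_abs p (X m - X n) < e / C" and
    N: "\<And>m n. m \<ge> N \<Longrightarrow> n \<ge> N \<Longrightarrow> padic_abs p (Y m - Y n) < e / B"
    using assms e B(1) C(1) unfolding padic_Cauchy_def by (meson divide_pos_pos)
  have "padic_abs p (X m * Y m - X n * Y n) < e" if "m \<ge> max M N" "n \<ge> max M N" for m n
  proof -
    have "padic_abs p (X m * (Y m - Y n)) \<le> B * padic_abs p (Y m - Y n)"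
      using B(2) by (simp add: padic_abs_mult[OF prime] mult_right_mono padic_abs_nonneg[OF prime])
    also have "\<dots> < e"
      using N[of m n] that B(1) by (simp add: field_simps)
    finally have 1: "padic_abs p (X m * (Y m - Y n)) < e" .
    have "padic_abs p ((X m - X n) * Y n) \<le> padic_abs p (X m - X n) * C"
      using C(2) by (simp add: padic_abs_mult[OF prime] mult_left_mono padic_abs_nonneg[OF prime])
    also have "\<dots> < e"
      using M[of m n] that C(1) by (simp add: field_simps)
    finally have 2: "padic_abs p ((X m - X n) * Y n) < e" .
    show ?thesis
      using padic_abs_ultrametric[OF prime, of "X m * (Y m - Y n)" "(X m - X n) * Y n"] 1 2
      by (simp add: algebra_simps)
  qed
  then show "\<exists>N. \<forall>m\<ge>N. \<forall>n\<ge>N. padic_abs p (X m * Y m - X n * Y n) < e"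
    by blast
qed

lemma padic_Cauchy_not_null:
  assumes "padic_Cauchy p X" "\<not> padic_null p X"
  obtains b N where "b > 0" "\<And>n. n \<ge> N \<Longrightarrow> b < padic_abs p (X n)"
proof -
  define L where "L = lim (\<lambda>n. padic_abs p (X n))"
  have L: "(\<lambda>n. padic_abs p (X n)) \<longlonglongrightarrow> L"
    using padic_Cauchy_abs_convergent[OF assms(1)] by (simp add: L_def)
  have "L \<ge> 0"
    by (rule LIMSEQ_le_const[OF L]) (simp add: padic_abs_nonneg[OF prime])
  moreover have "L \<noteq> 0"
    using L assms(2) by (auto simp: padic_null_def)
  ultimately have "L / 2 > 0" "L / 2 < L"
    by auto
  moreover obtain N where "\<And>n. n \<ge> N \<Longrightarrow> L / 2 < padic_abs p (X n)"
    using order_tendstoD(1)[OF L, of "L / 2"] calculation unfolding eventually_sequentially by blast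
  ultimately show thesis
    using that by blast
qed

lemma padic_Cauchy_inverse:
  assumes "padic_Cauchy p X" "\<not> padic_null p X"
  shows "padic_Cauchy p (\<lambda>n. inverse (X n))"
  unfolding padic_Cauchy_def
proof (intro allI impI)
  fix e :: real assume e: "e > 0"
  obtain b M where b: "b > 0" and M: "\<And>n. n \<ge> M \<Longrightarrow> b < padic_abs p (X n)"
    using padic_Cauchy_not_null[OF assms] by blast
  obtain N where N: "\<And>m n. m \<ge> N \<Longrightarrow> n \<ge> N \<Longrightarrow> padic_abs p (X m - X n) < e * (b * b)"
    using assms(1) e b unfolding padic_Cauchy_def by (meson mult_pos_pos)
  have "padic_abs p (inverse (X m) - inverse (X n)) < e" if "m \<ge> max M N" "n \<ge> max M N" for m n
  proof -
    have nz: "X m \<noteq> 0" "X n \<noteq> 0"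
      using M[of m] M[of n] b that by auto
    have bb: "b * b \<le> padic_abs p (X m) * padic_abs p (X n)"
      using M[of m] M[of n] b that by (intro mult_mono) auto
    have "inverse (X m) - inverse (X n) = (X n - X m) * inverse (X m * X n)"
      using nz by (simp add: field_simps)
    then have "padic_abs p (inverse (X m) - inverse (X n))
        = padic_abs p (X n - X m) / (padic_abs p (X m) * padic_abs p (X n))"
      by (simp only: padic_abs_mult[OF prime] padic_abs_inverse[OF prime] divide_inverse)
    also have "\<dots> \<le> padic_abs p (X n - X m) / (b * b)"
      using bb b less_le_trans[OF mult_pos_pos[OF b b] bb] mult_pos_pos
      by (intro divide_left_mono) (simp_all add: padic_abs_nonneg[OF prime])
    also have "\<dots> < e"
      using N[of n m] that b by (simp add: field_simps)
    finally show ?thesis .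
  qed
  then show "\<exists>N. \<forall>m\<ge>N. \<forall>n\<ge>N. padic_abs p (inverse (X m) - inverse (X n)) < e"
    by blast
qed

lemma padic_null_inverse_mult:
  assumes "padic_Cauchy p X" "\<not> padic_null p X"
  shows "padic_null p (\<lambda>n. inverse (X n) * X n - 1)"
proof -
  obtain b N where b: "b > 0" and N: "\<And>n. n \<ge> N \<Longrightarrow> b < padic_abs p (X n)"
    using padic_Cauchy_not_null[OF assms] by blast
  have "X n \<noteq> 0" if "n \<ge> N" for n
    using N[OF that] b by auto
  then have "\<forall>\<^sub>F n in sequentially. padic_abs p (inverse (X n) * X n - 1) = 0"
    unfolding eventually_sequentially by (intro exI[of _ N]) simp
  then show ?thesis
    unfolding padic_null_def by (rule tendsto_eventually)
qed

lemma padic_null_cong: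
  assumes "padic_null p (\<lambda>n. X n - Y n)"
  shows "padic_null p X \<longleftrightarrow> padic_null p Y"
  using padic_null_add[OF assms, of Y] padic_null_add[OF padic_null_minus[OF assms], of X] by auto

lemma padic_null_diff_inverse:
  assumes "padic_Cauchy p X" "\<not> padic_null p X" "padic_Cauchy p Y" "\<not> padic_null p Y"
    and XY: "padic_null p (\<lambda>n. X n - Y n)"
  shows "padic_null p (\<lambda>n. inverse (X n) - inverse (Y n))"
proof -
  let ?X = "\<lambda>n. inverse (X n)" and ?Y = "\<lambda>n. inverse (Y n)"
  have CX: "padic_Cauchy p ?X" and CY: "padic_Cauchy p ?Y"
    using assms padic_Cauchy_inverse by auto
  have 1: "padic_null p (\<lambda>n. ?Y n * (?X n * X n - 1))"
    using padic_null_mult[OF CY padic_null_inverse_mult[OF assms(1,2)]] .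
  have 2: "padic_null p (\<lambda>n. ?X n * (?Y n * Y n - 1))"
    using padic_null_mult[OF CX padic_null_inverse_mult[OF assms(3,4)]] .
  have 3: "padic_null p (\<lambda>n. - (?X n * ?Y n * (X n - Y n)))"
    using padic_null_minus[OF padic_null_mult[OF padic_Cauchy_mult[OF CX CY] XY]] .
  have "?X n - ?Y n = ?Y n * (?X n * X n - 1) + - (?X n * (?Y n * Y n - 1)) + - (?X n * ?Y n * (X n - Y n))" for n
    by (simp add: algebra_simps)
  then show ?thesis
    using padic_null_add[OF padic_null_add[OF 1 padic_null_minus[OF 2]] 3] by simp
qed

lemma padic_null_lim_eq:
  assumes "padic_Cauchy p X" "padic_Cauchy p Y" "padic_null p (\<lambda>n. X n - Y n)"
  shows "lim (\<lambda>n. padic_abs p (X n)) = lim (\<lambda>n. padic_abs p (Y n))"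
proof -
  have "(\<lambda>n. padic_abs p (X n) - padic_abs p (Y n)) \<longlonglongrightarrow> 0"
    by (rule Lim_null_comparison[OF _ assms(3)[unfolded padic_null_def]])
       (simp add: padic_abs_diff_abs[OF prime])
  then show ?thesis
    using LIMSEQ_unique[OF _ tendsto_diff[OF padic_Cauchy_abs_convergent[OF assms(1)]
      padic_Cauchy_abs_convergent[OF assms(2)]]] by fastforce
qed

end

text \<open>
  The prime is carried by the type: \<open>p = CARD('p)\<close> for a type \<open>'p\<close> of prime cardinality.
\<close>

definition padic_rel :: "'p::prime_card itself \<Rightarrow> (nat \<Rightarrow> rat) \<Rightarrow> (nat \<Rightarrow> rat) \<Rightarrow> bool" where
  "padic_rel _ X Y \<longleftrightarrow>
     padic_Cauchy CARD('p) X \<and> padic_Cauchy CARD('p) Y \<and> padic_null CARD('p) (\<lambda>n. X n - Y n)"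

lemma part_equivp_padic_rel: "part_equivp (padic_rel TYPE('p::prime_card))"
proof (rule part_equivpI)
  show "\<exists>X. padic_rel TYPE('p) X X"
    by (rule exI[of _ "\<lambda>_. 0"]) (simp add: padic_rel_def)
  show "symp (padic_rel TYPE('p))"
    by (rule sympI) (use padic_null_diff_commute[OF prime_card] in \<open>auto simp: padic_rel_def\<close>)
  show "transp (padic_rel TYPE('p))"
  proof (rule transpI)
    fix X Y Z :: "nat \<Rightarrow> rat"
    assume "padic_rel TYPE('p) X Y" "padic_rel TYPE('p) Y Z"
    then show "padic_rel TYPE('p) X Z"
      using padic_null_add[OF prime_card[where 'a = 'p], of "\<lambda>n. X n - Y n" "\<lambda>n. Y n - Z n"]
      by (simp add: padic_rel_def)
  qed
qed

typedef (overloaded) 'p padic =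
  "{C. \<exists>X. padic_rel TYPE('p::prime_card) X X \<and> C = Collect (padic_rel TYPE('p) X)}"
  morphisms padic_class Abs_padic
  by (auto intro!: exI[of _ "\<lambda>_. 0"] simp: padic_rel_def)

definition abs_padic :: "(nat \<Rightarrow> rat) \<Rightarrow> 'p::prime_card padic" where
  "abs_padic X = Abs_padic (Collect (padic_rel TYPE('p) X))"

definition rep_padic :: "'p::prime_card padic \<Rightarrow> (nat \<Rightarrow> rat)" where
  "rep_padic x = (SOME X. X \<in> padic_class x)"

definition cr_padic :: "(nat \<Rightarrow> rat) \<Rightarrow> 'p::prime_card padic \<Rightarrow> bool" where
  "cr_padic X x \<longleftrightarrow> padic_rel TYPE('p) X X \<and> abs_padic X = x"

lemma Quotient_padic:
  "Quotient (padic_rel TYPE('p::prime_card)) abs_padic rep_padic (cr_padic :: _ \<Rightarrow> 'p padic \<Rightarrow> bool)"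
proof -
  let ?R = "padic_rel TYPE('p)"
  have sym: "?R X Y \<Longrightarrow> ?R Y X" for X Y
    by (rule part_equivp_symp[OF part_equivp_padic_rel])
  have trans: "?R X Y \<Longrightarrow> ?R Y Z \<Longrightarrow> ?R X Z" for X Y Z
    by (rule part_equivp_transp[OF part_equivp_padic_rel])
  have Collect_eq: "Collect (?R X) = Collect (?R Y) \<longleftrightarrow> ?R X Y" if "?R X X" "?R Y Y" for X Y
  proof
    show "Collect (?R X) = Collect (?R Y) \<Longrightarrow> ?R X Y"
      using that by blast
    show "?R X Y \<Longrightarrow> Collect (?R X) = Collect (?R Y)"
      using sym trans by blast
  qed
  have abs_eq: "(abs_padic X :: 'p padic) = abs_padic Y \<longleftrightarrow> ?R X Y" if "?R X X" "?R Y Y" for X Y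
  proof -
    have "(abs_padic X :: 'p padic) = abs_padic Y \<longleftrightarrow> Collect (?R X) = Collect (?R Y)"
      unfolding abs_padic_def by (rule Abs_padic_inject) (use that in blast)+
    then show ?thesis
      using Collect_eq[OF that] by simp
  qed
  have rep: "?R (rep_padic x) (rep_padic x) \<and> abs_padic (rep_padic x) = x" for x :: "'p padic"
  proof -
    obtain X where X: "?R X X" "padic_class x = Collect (?R X)"
      using padic_class[of x] unfolding mem_Collect_eq by (elim exE conjE)
    have "X \<in> padic_class x"
      using X by simp
    then have "rep_padic x \<in> padic_class x"
      unfolding rep_padic_def by (rule someI[of "\<lambda>Y. Y \<in> padic_class x"])
    then have R: "?R X (rep_padic x)"
      using X by simp
    then have "?R (rep_padic x) (rep_padic x)"
      using sym trans by blast
    moreover have "Collect (?R (rep_padic x)) = padic_class x"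
      using R X(2) Collect_eq[OF X(1) calculation] by simp
    ultimately show ?thesis
      by (simp add: abs_padic_def padic_class_inverse)
  qed
  show ?thesis
  proof (rule QuotientI)
    show "abs_padic (rep_padic a) = a" for a :: "'p padic"
      using rep by blast
    show "?R (rep_padic a) (rep_padic a)" for a :: "'p padic"
      using rep by blast
    show "?R r s \<longleftrightarrow> ?R r r \<and> ?R s s \<and> (abs_padic r :: 'p padic) = abs_padic s" for r s
      using abs_eq sym trans by blast
    show "(cr_padic :: _ \<Rightarrow> 'p padic \<Rightarrow> bool) = (\<lambda>X x. ?R X X \<and> abs_padic X = x)"
      by (simp add: cr_padic_def fun_eq_iff)
  qed
qed

setup_lifting Quotient_padic

instantiation padic :: (prime_card) field
begin

lift_definition zero_padic :: "'a padic" is "\<lambda>_. 0"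
  by (simp add: padic_rel_def)

lift_definition one_padic :: "'a padic" is "\<lambda>_. 1"
  by (simp add: padic_rel_def)

lift_definition plus_padic :: "'a padic \<Rightarrow> 'a padic \<Rightarrow> 'a padic" is "\<lambda>X Y n. X n + Y n"
  unfolding padic_rel_def add_diff_add
  by (simp add: padic_Cauchy_add[OF prime_card] padic_null_add[OF prime_card])

lift_definition uminus_padic :: "'a padic \<Rightarrow> 'a padic" is "\<lambda>X n. - X n"
  unfolding padic_rel_def minus_diff_minus
  using padic_Cauchy_minus[OF prime_card] padic_null_minus[OF prime_card] by blast

lift_definition times_padic :: "'a padic \<Rightarrow> 'a padic \<Rightarrow> 'a padic" is "\<lambda>X Y n. X n * Y n"
proof -
  fix X X' Y Y' :: "nat \<Rightarrow> rat"
  assume X: "padic_rel TYPE('a) X X'" and Y: "padic_rel TYPE('a) Y Y'"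
  have "padic_null CARD('a) (\<lambda>n. X n * (Y n - Y' n) + Y' n * (X n - X' n))"
    using X Y unfolding padic_rel_def
    by (intro padic_null_add[OF prime_card] padic_null_mult[OF prime_card]) auto
  then have "padic_null CARD('a) (\<lambda>n. X n * Y n - X' n * Y' n)"
    by (simp add: algebra_simps)
  then show "padic_rel TYPE('a) (\<lambda>n. X n * Y n) (\<lambda>n. X' n * Y' n)"
    using X Y by (simp add: padic_rel_def padic_Cauchy_mult[OF prime_card])
qed

lift_definition inverse_padic :: "'a padic \<Rightarrow> 'a padic"
  is "\<lambda>X. if padic_null CARD('a) X then (\<lambda>_. 0) else (\<lambda>n. inverse (X n))"
proof -
  fix X Y :: "nat \<Rightarrow> rat"
  assume XY: "padic_rel TYPE('a) X Y"
  then have "padic_null CARD('a) X \<longleftrightarrow> padic_null CARD('a) Y"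
    unfolding padic_rel_def by (intro padic_null_cong[OF prime_card]) auto
  then show "padic_rel TYPE('a)
      (if padic_null CARD('a) X then (\<lambda>_. 0) else (\<lambda>n. inverse (X n)))
      (if padic_null CARD('a) Y then (\<lambda>_. 0) else (\<lambda>n. inverse (Y n)))"
    using XY
    by (auto simp: padic_rel_def padic_Cauchy_inverse[OF prime_card]
        intro: padic_null_diff_inverse[OF prime_card])
qed

definition "x - y = x + - y" for x y :: "'a padic"

definition "x div y = x * inverse y" for x y :: "'a padic"

instance
proof
  fix a b c :: "'a padic"
  show "(a + b) + c = a + (b + c)"
    by transfer (simp add: padic_rel_def padic_Cauchy_add[OF prime_card] ac_simps)
  show "a + b = b + a"
    by transfer (simp add: padic_rel_def padic_Cauchy_add[OF prime_card] ac_simps)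
  show "0 + a = a"
    by transfer (simp add: padic_rel_def)
  show "- a + a = 0"
    by transfer (simp add: padic_rel_def)
  show "a - b = a + - b"
    by (rule minus_padic_def)
  show "(a * b) * c = a * (b * c)"
    by transfer (simp add: padic_rel_def padic_Cauchy_mult[OF prime_card] ac_simps)
  show "a * b = b * a"
    by transfer (simp add: padic_rel_def padic_Cauchy_mult[OF prime_card] ac_simps)
  show "1 * a = a"
    by transfer (simp add: padic_rel_def)
  show "(a + b) * c = a * c + b * c"
    by transfer
       (simp add: padic_rel_def padic_Cauchy_mult[OF prime_card] padic_Cauchy_add[OF prime_card] distrib_right)
  show "(0 :: 'a padic) \<noteq> 1"
    by transfer (use padic_null_diff_commute[OF prime_card[where 'a = 'a], of "\<lambda>_. 0" "\<lambda>_. 1"]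
      in \<open>simp add: padic_rel_def\<close>)
  show "a \<noteq> 0 \<Longrightarrow> inverse a * a = 1"
    by transfer
       (simp add: padic_rel_def padic_null_inverse_mult[OF prime_card] padic_Cauchy_inverse[OF prime_card]
          padic_Cauchy_mult[OF prime_card])
  show "a div b = a * inverse b"
    by (rule divide_padic_def)
  show "inverse (0 :: 'a padic) = 0"
    by transfer (simp add: padic_rel_def)
qed

end

lift_definition padic_of_rat :: "rat \<Rightarrow> 'p::prime_card padic" is "\<lambda>r _. r"
  by (simp add: padic_rel_def)

lift_definition padic_norm :: "'p::prime_card padic \<Rightarrow> real"
  is "\<lambda>X. lim (\<lambda>n. padic_abs CARD('p) (X n))"
  unfolding padic_rel_def using padic_null_lim_eq[OF prime_card] by blast

lemma padic_norm_eq_0_iff: "padic_norm (x :: 'p::prime_card padic) = 0 \<longleftrightarrow> x = 0"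
proof transfer
  fix X :: "nat \<Rightarrow> rat"
  assume "padic_rel TYPE('p) X X"
  then have "padic_Cauchy CARD('p) X"
    by (simp add: padic_rel_def)
  moreover from this have "lim (\<lambda>n. padic_abs CARD('p) (X n)) = 0 \<longleftrightarrow> padic_null CARD('p) X"
    unfolding padic_null_def
    using padic_Cauchy_abs_convergent[OF prime_card] limI by metis
  ultimately show "lim (\<lambda>n. padic_abs CARD('p) (X n)) = 0 \<longleftrightarrow> padic_rel TYPE('p) X (\<lambda>_. 0)"
    by (simp add: padic_rel_def)
qed

lemma padic_norm_minus: "padic_norm (- x :: 'p::prime_card padic) = padic_norm x"
  by transfer (simp add: padic_abs_minus[OF prime_card])

lemma padic_norm_ultrametric: "padic_norm (x + y :: 'p::prime_card padic) \<le> max (padic_norm x) (padic_norm y)"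
proof transfer
  fix X Y :: "nat \<Rightarrow> rat"
  assume "padic_rel TYPE('p) X X" "padic_rel TYPE('p) Y Y"
  then have X: "padic_Cauchy CARD('p) X" and Y: "padic_Cauchy CARD('p) Y"
    by (simp_all add: padic_rel_def)
  show "lim (\<lambda>n. padic_abs CARD('p) (X n + Y n))
      \<le> max (lim (\<lambda>n. padic_abs CARD('p) (X n))) (lim (\<lambda>n. padic_abs CARD('p) (Y n)))"
    by (rule LIMSEQ_le[OF padic_Cauchy_abs_convergent[OF prime_card padic_Cauchy_add[OF prime_card X Y]]
          tendsto_max[OF padic_Cauchy_abs_convergent[OF prime_card X] padic_Cauchy_abs_convergent[OF prime_card Y]]])
       (simp add: padic_abs_ultrametric[OF prime_card])
qed

lemma padic_norm_nonneg: "padic_norm (x :: 'p::prime_card padic) \<ge> 0"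
  using padic_norm_ultrametric[of x "- x"] padic_norm_minus[of x] padic_norm_eq_0_iff[of 0]
  by (metis add.right_inverse max.idem)

instantiation padic :: (prime_card) metric_space
begin

definition dist_padic :: "'a padic \<Rightarrow> 'a padic \<Rightarrow> real" where
  "dist_padic x y = padic_norm (x - y)"

definition uniformity_padic :: "('a padic \<times> 'a padic) filter" where
  "uniformity_padic = (INF e\<in>{0<..}. principal {(x, y). dist x y < e})"

definition open_padic :: "'a padic set \<Rightarrow> bool" where
  "open_padic U \<longleftrightarrow> (\<forall>x\<in>U. \<forall>\<^sub>F (x', y) in uniformity. x' = x \<longrightarrow> y \<in> U)"

instance
proof
  fix x y z :: "'a padic"
  show "dist x y = 0 \<longleftrightarrow> x = y"
    by (simp add: dist_padic_def padic_norm_eq_0_iff)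
  have "padic_norm (x - y) \<le> max (padic_norm (x - z)) (padic_norm (z - y))"
    using padic_norm_ultrametric[of "x - z" "z - y"] by simp
  also have "\<dots> \<le> padic_norm (x - z) + padic_norm (z - y)"
    using padic_norm_nonneg[of "x - z"] padic_norm_nonneg[of "z - y"] by simp
  also have "padic_norm (z - y) = padic_norm (y - z)"
    using padic_norm_minus[of "y - z"] by simp
  finally show "dist x y \<le> dist x z + dist y z"
    by (simp add: dist_padic_def)
qed (rule uniformity_padic_def open_padic_def)+

end

lemma padic_norm_of_rat: "padic_norm (padic_of_rat r :: 'p::prime_card padic) = padic_abs CARD('p) r"
  by transfer simp

lemma padic_norm_mult: "padic_norm (x * y :: 'p::prime_card padic) = padic_norm x * padic_norm y"
proof transfer
  fix X Y :: "nat \<Rightarrow> rat"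
  assume "padic_rel TYPE('p) X X" "padic_rel TYPE('p) Y Y"
  then have X: "padic_Cauchy CARD('p) X" and Y: "padic_Cauchy CARD('p) Y"
    by (simp_all add: padic_rel_def)
  show "lim (\<lambda>n. padic_abs CARD('p) (X n * Y n))
      = lim (\<lambda>n. padic_abs CARD('p) (X n)) * lim (\<lambda>n. padic_abs CARD('p) (Y n))"
    unfolding padic_abs_mult[OF prime_card]
    by (rule limI) (intro tendsto_mult padic_Cauchy_abs_convergent[OF prime_card] X Y)
qed


section \<open>Haar measure, weighted Lebesgue spaces and the operator \<open>H\<close>\<close>

text \<open>
  On \<open>\<rat>\<^sub>p\<close>, a locally compact group with a countable base, every Borel measure
  that is finite on compact sets is regular, so regularity is not listed here.
\<close>

definition haar_measure :: "'a::{ab_group_add, topological_space} measure \<Rightarrow> bool" where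
  "haar_measure M \<longleftrightarrow>
     sets M = sets borel \<and>
     emeasure M UNIV \<noteq> 0 \<and>
     (\<forall>K. compact K \<longrightarrow> emeasure M K < \<infinity>) \<and>
     (\<forall>a. \<forall>A\<in>sets M. emeasure M ((+) a ` A) = emeasure M A)"

definition normalized_padic_haar :: "'p::prime_card padic measure \<Rightarrow> bool" where
  "normalized_padic_haar M \<longleftrightarrow> haar_measure M \<and> emeasure M {x. padic_norm x \<le> 1} = 1"

text \<open>
  Functions on \<open>\<rat>\<^sub>p\<^sup>*\<close> are represented by functions on \<open>\<rat>\<^sub>p\<close> whose value at \<open>0\<close> is irrelevant;
  all integrals and measurability conditions are over the set \<open>- {0}\<close>.
\<close>

definition Lq_space :: "'p::prime_card padic measure \<Rightarrow> real \<Rightarrow> real \<Rightarrow> ('p padic \<Rightarrow> real) set" where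
  "Lq_space M q \<theta> =
     {f. set_borel_measurable M (- {0}) f \<and>
         set_integrable M (- {0}) (\<lambda>x. \<bar>f x\<bar> powr q * padic_norm x powr \<theta>)}"

definition Lq_norm :: "'p::prime_card padic measure \<Rightarrow> real \<Rightarrow> real \<Rightarrow> ('p padic \<Rightarrow> real) \<Rightarrow> real" where
  "Lq_norm M q \<theta> f = (LINT x:- {0}|M. \<bar>f x\<bar> powr q * padic_norm x powr \<theta>) powr (1 / q)"

text \<open>The parameter \<open>lam\<close> is the exponent \<open>\<lambda>\<close> of the operator.\<close>

definition H_kernel ::
    "real \<Rightarrow> real \<Rightarrow> real \<Rightarrow> 'p::prime_card padic \<Rightarrow> 'p padic \<Rightarrow> real" where
  "H_kernel lam \<mu> \<nu> x y =
     padic_norm x powr \<mu> * padic_norm y powr \<nu> / (max (padic_norm x) (padic_norm y)) powr lam"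

definition H_op ::
    "'p::prime_card padic measure \<Rightarrow> real \<Rightarrow> real \<Rightarrow> real \<Rightarrow> ('p padic \<Rightarrow> real) \<Rightarrow> 'p padic \<Rightarrow> real" where
  "H_op M lam \<mu> \<nu> f y = (LINT x:- {0}|M. H_kernel lam \<mu> \<nu> x y * f x)"

text \<open>
  Membership of the image in the target space is stated explicitly because \<open>Lq_norm\<close>
  is a Bochner integral, which is \<open>0\<close> for a non-integrable function.
\<close>

definition H_bounded ::
    "'p::prime_card padic measure \<Rightarrow> real \<Rightarrow> real \<Rightarrow> real \<Rightarrow> real \<Rightarrow> real \<Rightarrow> real \<Rightarrow> bool" where
  "H_bounded M lam \<mu> \<nu> q \<alpha> \<beta> \<longleftrightarrow>
     (\<forall>f\<in>Lq_space M q \<alpha>.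
        AE y in M. y \<noteq> 0 \<longrightarrow> set_integrable M (- {0}) (\<lambda>x. H_kernel lam \<mu> \<nu> x y * f x)) \<and>
     (\<exists>C. \<forall>f\<in>Lq_space M q \<alpha>.
        H_op M lam \<mu> \<nu> f \<in> Lq_space M q \<beta> \<and>
        Lq_norm M q \<beta> (H_op M lam \<mu> \<nu> f) \<le> C * Lq_norm M q \<alpha> f)"

text \<open>
  \<open>f \<noteq> 0\<close> is understood in the space of classes modulo equality almost everywhere.
\<close>

definition H_opnorm ::
    "'p::prime_card padic measure \<Rightarrow> real \<Rightarrow> real \<Rightarrow> real \<Rightarrow> real \<Rightarrow> real \<Rightarrow> real \<Rightarrow> real" where
  "H_opnorm M lam \<mu> \<nu> q \<alpha> \<beta> =
     (SUP f \<in> {f \<in> Lq_space M q \<alpha>. \<not> (AE x in M. x \<noteq> 0 \<longrightarrow> f x = 0)}.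
        Lq_norm M q \<beta> (H_op M lam \<mu> \<nu> f) / Lq_norm M q \<alpha> f)"

end

theory Submission
  imports Defs
begin

text \<open>
  The kernel depends only on the norms of \<open>x\<close> and \<open>y\<close>, so everything is decided on the spheres
  \<open>|x| = p\<^sup>k\<close>, whose measure is \<open>(1 - 1/p) p\<^sup>k\<close>. Put \<open>A = \<mu> + 1 - (\<alpha> + 1)/q\<close> and
  \<open>B = \<nu> + (\<beta> + 1)/q\<close>. In terms of the functions \<open>|x|\<close> to the power \<open>-(\<alpha> + 1)/q\<close>, cut off to a
  sphere, the operator is the matrix \<open>(1 - 1/p) G(k, j)\<close> on \<open>\<ell>\<^sup>q(\<int>)\<close>, where \<open>G(k, j)\<close> is \<open>p\<close> to
  the power \<open>k A + j B - \<lambda> max(k, j)\<close>. Testing on one sphere forces the diagonal of \<open>G\<close> to be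
  bounded, i.e. \<open>\<lambda> = A + B\<close>, and its rows to be \<open>q\<close>-summable, i.e. \<open>A, B > 0\<close>. Conversely, \<open>G\<close> is
  then a convolution whose total mass is the stated norm. The Schur test with weight \<open>|x|\<close> to the
  power \<open>-(\<alpha> + 1)/q\<close> gives the upper bound with this constant, and the same weight cut off to \<open>n\<close>
  consecutive spheres, \<open>n \<rightarrow> \<infinity>\<close>, shows that it is sharp.
\<close>

section \<open>The value group and the digits of \<open>\<rat>\<^sub>p\<close>\<close>

lemma CARD_prime_card_gt_1: "1 < real CARD('p::prime_card)"
  using prime_gt_1_nat[OF prime_card[where 'a = 'p]] by simp

lemma padic_of_rat_diff:
  "padic_of_rat (r - s) = (padic_of_rat r - padic_of_rat s :: 'p::prime_card padic)"
proof -
  have "padic_of_rat (r + s) = (padic_of_rat r + padic_of_rat s :: 'p::prime_card padic)" for r s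
    by transfer (simp add: padic_rel_def)
  moreover have "padic_of_rat (- r) = (- padic_of_rat r :: 'p::prime_card padic)" for r
    by transfer (simp add: padic_rel_def)
  ultimately show ?thesis
    by (metis diff_conv_add_uminus)
qed

lemma padic_norm_0 [simp]: "padic_norm (0 :: 'p::prime_card padic) = 0"
  by (simp add: padic_norm_eq_0_iff)

lemma padic_norm_pos: "x \<noteq> 0 \<Longrightarrow> 0 < padic_norm (x :: 'p::prime_card padic)"
  using padic_norm_nonneg[of x] padic_norm_eq_0_iff[of x] by linarith

lemma padic_norm_minus_commute:
  "padic_norm (x - y :: 'p::prime_card padic) = padic_norm (y - x)"
  using padic_norm_minus[of "x - y"] by simp

lemma padic_norm_ultrametric_diff:
  "padic_norm (x - y :: 'p::prime_card padic) \<le> max (padic_norm x) (padic_norm y)"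
  using padic_norm_ultrametric[of x "- y"] by (simp add: padic_norm_minus)

text \<open>A late term of a Cauchy sequence representing \<open>x\<close> is as close to
  \<open>x\<close> as desired.\<close>

lemma padic_of_rat_dense:
  fixes x :: "'p::prime_card padic"
  assumes "e > 0"
  shows "\<exists>r. padic_norm (x - padic_of_rat r) < e"
proof -
  have *: "\<exists>r. padic_norm (x + - padic_of_rat r) < e"
    using assms
  proof transfer
    fix e :: real and X :: "nat \<Rightarrow> rat"
    assume "padic_rel TYPE('p) X X" and e: "0 < e"
    then have X: "padic_Cauchy CARD('p) X"
      by (simp add: padic_rel_def)
    \<comment> \<open>\<open>e / 2\<close> is requested because the limit only preserves a
      non-strict bound.\<close>
    then obtain N where N: "\<And>m n. m \<ge> N \<Longrightarrow> n \<ge> N \<Longrightarrow> padic_abs CARD('p) (X m - X n) < e / 2"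
      using e unfolding padic_Cauchy_def by (meson half_gt_zero)
    have "padic_Cauchy CARD('p) (\<lambda>n. X n + - X N)"
      by (intro padic_Cauchy_add[OF prime_card] X) simp
    from padic_Cauchy_abs_convergent[OF prime_card this]
    have "lim (\<lambda>n. padic_abs CARD('p) (X n + - X N)) \<le> e / 2"
      by (rule LIMSEQ_le_const2) (use N in \<open>auto intro!: exI[of _ N] less_imp_le\<close>)
    with e show "\<exists>r. lim (\<lambda>n. padic_abs CARD('p) (X n + - r)) < e"
      by (intro exI[of _ "X N"]) simp
  qed
  then show ?thesis by simp
qed

text \<open>Ultrametric triangles are isosceles: \<open>x - y\<close> is a short side, so
  \<open>x\<close> and \<open>y\<close> are the two longest ones.\<close>

lemma padic_norm_eq_of_closer:
  fixes x y :: "'p::prime_card padic"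
  assumes "padic_norm (x - y) < padic_norm x"
  shows "padic_norm y = padic_norm x"
  using padic_norm_ultrametric[of "x - y" y] padic_norm_ultrametric_diff[of x "x - y"] assms
  by simp

lemma padic_abs_eq_powr:
  assumes "prime p" "r \<noteq> 0"
  shows "padic_abs p r = real p powr real_of_int (- padic_val p r)"
  using assms prime_gt_0_nat[OF assms(1)] by (subst powr_real_of_int') (simp_all add: padic_abs_def)

text \<open>Completion adds no new norms: a rational closer to \<open>x\<close> than
  \<open>0\<close> is has the norm of \<open>x\<close>, and norms of nonzero rationals are powers of
  the prime.\<close>

lemma padic_norm_eq_powr:
  fixes x :: "'p::prime_card padic"
  assumes "x \<noteq> 0"
  shows "\<exists>k::int. padic_norm x = real CARD('p) powr k"
proof -
  obtain r where "padic_norm (x - padic_of_rat r) < padic_norm x"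
    using padic_of_rat_dense padic_norm_pos[OF assms] by blast
  then have eq: "padic_abs CARD('p) r = padic_norm x"
    using padic_norm_eq_of_closer[of x "padic_of_rat r"] by (simp add: padic_norm_of_rat)
  moreover have "r \<noteq> 0"
    using eq padic_norm_pos[OF assms] by auto
  ultimately show ?thesis
    using padic_abs_eq_powr[OF prime_card[where 'a = 'p]] by metis
qed

text \<open>Powers of \<open>p\<close> are the witnesses; as \<open>p\<close> has norm
  \<open>1 / p\<close>, a nonnegative \<open>k\<close> calls for the inverse of
  \<open>p ^ k\<close>.\<close>

lemma padic_norm_surj:
  fixes k :: int
  shows "\<exists>x :: 'p::prime_card padic. padic_norm x = real CARD('p) powr k"
proof -
  define p where "p = CARD('p)"
  have p: "prime p" and p1: "real p > 1"
    using prime_card[where 'a = 'p] CARD_prime_card_gt_1[where 'p = 'p] by (simp_all add: p_def)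
  have pp: "padic_abs p (of_nat p) = inverse (real p)"
    using padic_abs_fraction[OF p, of "int p" 1] p1 p
    by (simp add: power_int_minus)
  have pw: "padic_abs p (of_nat p ^ n) = inverse (real p) ^ n" for n
    by (induction n) (simp_all add: padic_abs_mult[OF p] pp)
  have "\<exists>r. padic_abs p r = real p powr k"
  proof (cases "k \<ge> 0")
    case True
    have "padic_abs p (inverse (of_nat p ^ nat k)) = real p powr k"
      using p1 True
      by (subst powr_real_of_int') (simp_all add: padic_abs_inverse[OF p] pw power_int_def power_inverse)
    then show ?thesis by blast
  next
    case False
    have "padic_abs p (of_nat p ^ nat (- k)) = real p powr k"
      using p1 False by (subst powr_real_of_int') (simp_all add: pw power_int_def)
    then show ?thesis by blast
  qed
  then show ?thesis
    by (metis padic_norm_of_rat p_def)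
qed

section \<open>Digits modulo \<open>p\<close> and the partition of a ball into \<open>p\<close>
  smaller balls\<close>

lemma padic_abs_of_int:
  assumes p: "prime p"
  shows padic_abs_of_int_le_1: "padic_abs p (of_int n) \<le> 1"
    and padic_abs_of_int_less_1_iff: "padic_abs p (of_int n) < 1 \<longleftrightarrow> int p dvd n"
proof -
  have p1: "real p > 1"
    using prime_gt_1_nat[OF p] by simp
  have "padic_abs p (of_int n) \<le> 1 \<and> (padic_abs p (of_int n) < 1 \<longleftrightarrow> int p dvd n)"
  proof (cases "n = 0")
    case False
    have "padic_abs p (of_int n) = inverse (real p ^ multiplicity (int p) n)"
      using padic_abs_fraction[OF p False, of 1] by (simp add: power_int_minus)
    moreover have "multiplicity (int p) n > 0 \<longleftrightarrow> int p dvd n"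
      using False p by (simp add: prime_multiplicity_gt_zero_iff)
    ultimately show ?thesis
      using p1 by (cases "multiplicity (int p) n")
        (simp_all add: inverse_less_1_iff inverse_le_1_iff one_less_power del: power_Suc)
  qed auto
  then show "padic_abs p (of_int n) \<le> 1" "padic_abs p (of_int n) < 1 \<longleftrightarrow> int p dvd n"
    by auto
qed

text \<open>Approximate \<open>x\<close> by a fraction \<open>u / v\<close> in lowest terms. Norm at
  most 1 keeps \<open>p\<close> from dividing \<open>v\<close>, and the digit is \<open>u\<close>
  times an inverse of \<open>v\<close> modulo \<open>p\<close>.\<close>

lemma padic_digit_exists:
  fixes x :: "'p::prime_card padic"
  assumes "padic_norm x \<le> 1"
  shows "\<exists>a<CARD('p). padic_norm (x - padic_of_rat (of_nat a)) < 1"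
proof -
  define p where "p = CARD('p)"
  have p: "prime p"
    using prime_card[where 'a = 'p] by (simp add: p_def)
  obtain r where r: "padic_norm (x - padic_of_rat r) < 1"
    using padic_of_rat_dense[of 1 x] by auto
  obtain u v where uv: "quotient_of r = (u, v)"
    by (cases "quotient_of r")
  have v: "v > 0" and cop: "coprime u v" and ruv: "r = of_int u / of_int v"
    using quotient_of_denom_pos[OF uv] quotient_of_coprime[OF uv] quotient_of_div[OF uv] by auto
  have "padic_abs p r \<le> 1"
    using padic_norm_ultrametric_diff[of x "x - padic_of_rat r"] assms r
    by (simp add: padic_norm_of_rat p_def)
  then have le: "padic_abs p (of_int u) \<le> padic_abs p (of_int v)"
    using padic_abs_mult[OF p, of r "of_int v"] v padic_abs_nonneg[OF p, of "of_int v"]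
      mult_right_mono[of "padic_abs p r" 1 "padic_abs p (of_int v)"]
    by (simp add: ruv)
  \<comment> \<open>A factor \<open>p\<close> of \<open>v\<close> would by \<open>le\<close> be a
    factor of \<open>u\<close> as well.\<close>
  have ndvd: "\<not> int p dvd v"
  proof
    assume "int p dvd v"
    moreover from this have "int p dvd u"
      using le padic_abs_of_int_less_1_iff[OF p] by (meson le_less_trans)
    ultimately have "is_unit (int p)"
      using cop by (meson coprime_common_divisor)
    then show False
      using prime_gt_1_nat[OF p] by simp
  qed
  have v1: "padic_abs p (of_int v) = 1"
    using ndvd padic_abs_of_int[OF p, of v] by linarith
  have "coprime v (int p)"
    using ndvd p by (metis coprime_commute prime_imp_coprime prime_nat_int_transfer)
  then obtain w where w: "[v * w = 1] (mod int p)"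
    using cong_solve_coprime_int by blast
  define a where "a = nat ((w * u) mod int p)"
  have a: "int a = (w * u) mod int p" "a < p"
    using prime_gt_0_nat[OF p] by (auto simp: a_def nat_less_iff)
  have "[v * int a = v * (w * u)] (mod int p)"
    by (intro cong_mult) (auto simp: a cong_def)
  also have "[v * (w * u) = 1 * u] (mod int p)"
    unfolding mult.assoc[symmetric] by (intro cong_mult w) auto
  finally have "int p dvd v * int a - u"
    by (simp add: cong_iff_dvd_diff)
  then have "int p dvd u - v * int a"
    by (simp add: dvd_diff_commute)
  \<comment> \<open>The numerator is divisible by \<open>p\<close> and \<open>v\<close> has norm 1,
    so the quotient has norm below 1.\<close>
  moreover have "r - of_nat a = of_int (u - v * int a) * inverse (of_int v)"
    using v by (simp add: ruv field_simps)
  ultimately have "padic_abs p (r - of_nat a) < 1"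
    using padic_abs_of_int_less_1_iff[OF p, of "u - v * int a"]
    by (simp add: padic_abs_mult[OF p] padic_abs_inverse[OF p] v1)
  then have "padic_norm (padic_of_rat r - padic_of_rat (of_nat a) :: 'p padic) < 1"
    by (simp add: padic_of_rat_diff[symmetric] padic_norm_of_rat p_def)
  then have "padic_norm (x - padic_of_rat (of_nat a)) < 1"
    using r padic_norm_ultrametric[of "x - padic_of_rat r" "padic_of_rat r - padic_of_rat (of_nat a)"]
    by simp
  with a(2) show ?thesis
    by (auto simp: p_def)
qed

text \<open>Two digits differ by a nonzero integer of absolute value below \<open>p\<close>, hence
  prime to \<open>p\<close>.\<close>

lemma padic_digit_separated:
  assumes "a < CARD('p::prime_card)" "b < CARD('p)" "a \<noteq> b"
  shows "padic_norm (padic_of_rat (of_nat a) - padic_of_rat (of_nat b) :: 'p padic) = 1"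
proof -
  have "\<not> int CARD('p) dvd int a - int b"
    using assms by (auto dest!: zdvd_imp_le[rotated] simp: dvd_diff_commute)
      (metis assms cong_iff_dvd_diff cong_int_iff cong_less_modulus_unique_nat)
  then have "padic_abs CARD('p) (of_int (int a - int b)) = 1"
    using padic_abs_of_int[OF prime_card[where 'a = 'p], of "int a - int b"] by linarith
  then show ?thesis
    by (simp add: padic_of_rat_diff[symmetric] padic_norm_of_rat)
qed

text \<open>The partition of the closed unit ball into cosets of the open unit ball, with the digits
  as representatives, rescaled by \<open>t\<close>.\<close>

lemma padic_ball_decomposition:
  fixes t :: "'p::prime_card padic"
  assumes t: "t \<noteq> 0"
  defines "D \<equiv> {x. padic_norm x < padic_norm t}"
  shows "{x. padic_norm x \<le> padic_norm t} =
           (\<Union>a<CARD('p). (+) (padic_of_rat (of_nat a) * t) ` D)" (is "?L = ?R")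
    and "disjoint_family_on (\<lambda>a. (+) (padic_of_rat (of_nat a) * t) ` D) {..<CARD('p)}"
proof -
  have tpos: "padic_norm t > 0"
    by (rule padic_norm_pos[OF t])
  have mem: "x \<in> (+) y ` D \<longleftrightarrow> padic_norm (x - y) < padic_norm t" for x y
    by (auto simp: D_def image_iff intro!: bexI[of _ "x - y"])
  show "?L = ?R"
  proof (intro equalityI subsetI)
    fix x assume "x \<in> ?L"
    moreover have x: "x = (x / t) * t"
      using t by simp
    ultimately have "padic_norm (x / t) * padic_norm t \<le> 1 * padic_norm t"
      by (metis mem_Collect_eq mult_1 padic_norm_mult)
    then have "padic_norm (x / t) \<le> 1"
      using tpos by (simp only: mult_le_cancel_right_pos)
    then obtain a where a: "a < CARD('p)" "padic_norm (x / t - padic_of_rat (of_nat a)) < 1"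
      using padic_digit_exists by blast
    have "padic_norm (x - padic_of_rat (of_nat a) * t) =
        padic_norm (x / t - padic_of_rat (of_nat a)) * padic_norm t"
      using t by (simp add: padic_norm_mult[symmetric] left_diff_distrib)
    also have "\<dots> < padic_norm t"
      using a tpos by simp
    finally show "x \<in> ?R"
      using a(1) by (auto simp: mem)
  next
    fix x assume "x \<in> ?R"
    then obtain a where a: "padic_norm (x - padic_of_rat (of_nat a) * t) < padic_norm t"
      by (auto simp: mem)
    have "padic_norm (padic_of_rat (of_nat a) * t) \<le> padic_norm t"
      using padic_abs_of_int_le_1[OF prime_card[where 'a = 'p], of "int a"] tpos
      by (simp add: padic_norm_mult padic_norm_of_rat)
    with a show "x \<in> ?L"
      using padic_norm_ultrametric[of "x - padic_of_rat (of_nat a) * t" "padic_of_rat (of_nat a) * t"]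
      by simp
  qed
  show "disjoint_family_on (\<lambda>a. (+) (padic_of_rat (of_nat a) * t) ` D) {..<CARD('p)}"
    unfolding disjoint_family_on_def
  proof (intro ballI impI)
    fix a b assume ab: "a \<in> {..<CARD('p)}" "b \<in> {..<CARD('p)}" "a \<noteq> b"
    let ?a = "padic_of_rat (of_nat a) :: 'p padic" and ?b = "padic_of_rat (of_nat b) :: 'p padic"
    have "padic_norm (?a * t - ?b * t) = padic_norm t"
      using padic_digit_separated[where 'p = 'p and a = a and b = b] ab
      by (simp add: left_diff_distrib[symmetric] padic_norm_mult)
    \<comment> \<open>A common point would put the two centres at distance less than
      \<open>padic_norm t\<close>.\<close>
    then have "\<not> (padic_norm (x - ?a * t) < padic_norm t \<and> padic_norm (x - ?b * t) < padic_norm t)" for x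
      using padic_norm_ultrametric_diff[of "x - ?b * t" "x - ?a * t"]
      by (auto simp: max_def split: if_splits)
    then show "(+) (?a * t) ` D \<inter> (+) (?b * t) ` D = {}"
      unfolding disjoint_iff mem by blast
  qed
qed

section \<open>Haar measure of balls and spheres\<close>

definition padic_sphere :: "int \<Rightarrow> 'p::prime_card padic set" where
  "padic_sphere k = {x. padic_norm x = real CARD('p) powr k}"

lemma continuous_on_padic_norm: "continuous_on UNIV (padic_norm :: 'p::prime_card padic \<Rightarrow> real)"
proof -
  have "\<bar>padic_norm x - padic_norm y\<bar> \<le> dist x y" for x y :: "'p padic"
    using dist_triangle[of x 0 y] dist_triangle[of y 0 x]
    by (simp add: dist_padic_def padic_norm_minus_commute)
  then show ?thesis
    unfolding continuous_on_iff dist_real_def by (meson le_less_trans)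
qed

lemma borel_measurable_padic_norm [measurable]:
  "(padic_norm :: 'p::prime_card padic \<Rightarrow> real) \<in> borel_measurable borel"
  by (rule borel_measurable_continuous_onI[OF continuous_on_padic_norm])

locale padic_haar =
  fixes M :: "'p::prime_card padic measure" and p :: nat
  assumes p_eq: "p = CARD('p)" and normalized: "normalized_padic_haar M"
begin

lemma p_gt_1: "1 < real p"
  using CARD_prime_card_gt_1[where 'p = 'p] by (simp add: p_eq)

lemma sets_M [measurable_cong]: "sets M = sets borel"
  using normalized by (simp add: normalized_padic_haar_def haar_measure_def)

lemma space_M [simp]: "space M = UNIV"
  using sets_eq_imp_space_eq[OF sets_M] by simp

text \<open>No norm lies strictly between consecutive powers of \<open>p\<close>.\<close>

lemma padic_norm_less_powr_iff:
  fixes x :: "'p padic"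
  shows "padic_norm x < real p powr real_of_int (k + 1) \<longleftrightarrow> padic_norm x \<le> real p powr k"
proof (cases "x = 0")
  case False
  then obtain l :: int where l: "padic_norm x = real p powr l"
    using padic_norm_eq_powr p_eq by metis
  show ?thesis
    unfolding l powr_less_cancel_iff[OF p_gt_1] powr_le_cancel_iff[OF p_gt_1]
    by (simp only: of_int_less_iff of_int_le_iff zle_add1_eq_le)
qed (use p_gt_1 in simp)

text \<open>The larger ball splits into \<open>p\<close> translates of the smaller one, all of equal
  measure by invariance.\<close>

lemma emeasure_ball_Suc:
  "emeasure M {x. padic_norm x \<le> real p powr real_of_int (k + 1)} =
     of_nat p * emeasure M {x. padic_norm x \<le> real p powr real_of_int k}"
proof -
  obtain t :: "'p padic" where t: "padic_norm t = real p powr real_of_int (k + 1)"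
    using padic_norm_surj[of "k + 1"] p_eq by metis
  have t0: "t \<noteq> 0"
    using t p_gt_1 by auto
  define D where "D = {x :: 'p padic. padic_norm x < padic_norm t}"
  have D [measurable]: "D \<in> sets M"
    unfolding D_def by measurable
  \<comment> \<open>A translate is the preimage of a ray under a continuous function, hence Borel;
    additivity of the measure needs this.\<close>
  have img: "(+) a ` D \<in> sets M" for a
  proof -
    have "(+) a ` D = {x. padic_norm (x - a) < padic_norm t}"
      by (force simp: D_def image_iff intro: exI[of _ "_ - a"])
    moreover have "continuous_on UNIV (\<lambda>x. padic_norm (x - a))"
    proof (rule continuous_on_compose2[OF continuous_on_padic_norm])
      show "continuous_on UNIV (\<lambda>x. x - a)"
        unfolding continuous_on_iff by (auto simp: dist_padic_def)
    qed auto
    then have "(\<lambda>x. padic_norm (x - a)) \<in> borel_measurable M"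
      using borel_measurable_continuous_onI measurable_cong_sets[OF sets_M refl] by blast
    ultimately show ?thesis
      by simp
  qed
  have inv: "emeasure M ((+) a ` D) = emeasure M D" for a
    using normalized D by (simp add: normalized_padic_haar_def haar_measure_def)
  have "emeasure M {x. padic_norm x \<le> padic_norm t} = (\<Sum>a<CARD('p). emeasure M D)"
    unfolding padic_ball_decomposition(1)[OF t0]
    using padic_ball_decomposition(2)[OF t0] img inv
    by (subst sum_emeasure[symmetric]) (auto simp: D_def)
  also have "\<dots> = of_nat p * emeasure M D"
    by (simp add: p_eq)
  also have "D = {x. padic_norm x \<le> real p powr real_of_int k}"
    by (simp only: D_def t padic_norm_less_powr_iff)
  finally show ?thesis
    by (simp only: t)
qed

text \<open>Two-sided induction from the normalization, which is the case
  \<open>k = 0\<close>.\<close>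

lemma emeasure_ball: "emeasure M {x. padic_norm x \<le> real p powr real_of_int k} = ennreal (real p powr k)"
proof (induction k rule: int_induct[where k = 0])
  case base
  then show ?case
    using normalized p_gt_1 by (simp add: normalized_padic_haar_def)
next
  case (step1 i)
  then show ?case
    using p_gt_1 emeasure_ball_Suc[of i]
    by (simp add: powr_add mult.commute ennreal_mult ennreal_of_nat_eq_real_of_nat)
next
  case (step2 i)
  let ?m = "emeasure M {x. padic_norm x \<le> real p powr real_of_int (i - 1)}"
  \<comment> \<open>Downwards the recursion is read backwards, cancelling the finite nonzero factor
    \<open>p\<close>.\<close>
  have "of_nat p * ?m = of_nat p * ennreal (real p powr real_of_int (i - 1))"
    using emeasure_ball_Suc[of "i - 1"] step2 p_gt_1
    by (simp add: powr_diff ennreal_mult[symmetric] ennreal_of_nat_eq_real_of_nat)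
  then show ?case
    using p_gt_1 by (subst (asm) ennreal_mult_cancel_left) auto
qed

lemma sphere_sets [measurable]: "padic_sphere k \<in> sets M"
  unfolding padic_sphere_def by measurable

text \<open>The sphere is the difference of consecutive closed balls, of measures
  \<open>p powr k\<close> and \<open>p powr (k - 1)\<close>.\<close>

lemma emeasure_sphere:
  "emeasure M (padic_sphere k) = ennreal ((1 - 1 / real p) * real p powr real_of_int k)"
proof -
  let ?B = "\<lambda>k::int. {x::'p padic. padic_norm x \<le> real p powr real_of_int k}"
  have B: "?B k \<in> sets M" for k
    by measurable
  have lt: "padic_norm x \<le> real p powr real_of_int (k - 1) \<longleftrightarrow> padic_norm x < real p powr real_of_int k"
    for x :: "'p padic"
    using padic_norm_less_powr_iff[of x "k - 1"] by (simp only: diff_add_cancel)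
  have "padic_sphere k = ?B k - ?B (k - 1)"
    unfolding lt padic_sphere_def p_eq[symmetric] by auto
  moreover have "?B (k - 1) \<subseteq> ?B k"
    unfolding lt by auto
  moreover have "emeasure M (?B (k - 1)) \<noteq> \<infinity>"
    unfolding emeasure_ball by simp
  ultimately have "emeasure M (padic_sphere k) = emeasure M (?B k) - emeasure M (?B (k - 1))"
    by (simp only: emeasure_Diff B not_False_eq_True)
  also have "\<dots> = ennreal ((1 - 1 / real p) * real p powr real_of_int k)"
    using p_gt_1 unfolding emeasure_ball
    by (simp add: ennreal_minus powr_diff left_diff_distrib)
  finally show ?thesis .
qed

section \<open>Decomposition of the nonzero elements into spheres\<close>

lemma sphere_unique: "x \<in> padic_sphere k \<Longrightarrow> x \<in> (padic_sphere l :: 'p padic set) \<longleftrightarrow> k = l"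
  using p_gt_1 powr_inj[of "real p" "real_of_int k" "real_of_int l"]
  by (auto simp: padic_sphere_def p_eq)

lemma sphere_exists:
  fixes x :: "'p padic"
  assumes "x \<noteq> 0"
  obtains k where "x \<in> padic_sphere k"
  using padic_norm_eq_powr[OF assms] by (auto simp: padic_sphere_def)

lemma sphere_nonzero: "x \<in> (padic_sphere k :: 'p padic set) \<Longrightarrow> x \<noteq> 0"
  using p_gt_1 by (auto simp: padic_sphere_def p_eq)

lemma padic_norm_sphere:
  "x \<in> (padic_sphere k :: 'p padic set) \<Longrightarrow> padic_norm x = real p powr real_of_int k"
  by (simp add: padic_sphere_def p_eq)

text \<open>Needed for Tonelli and for measurability of \<open>H_op\<close>; the balls of radius
  \<open>p ^ n\<close> exhaust the field.\<close>

lemma sigma_finite_M: "sigma_finite_measure M"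
proof
  let ?B = "\<lambda>n::nat. {x::'p padic. padic_norm x \<le> real p powr real_of_int (int n)}"
  have "\<exists>n. x \<in> ?B n" for x
  proof -
    obtain n where "padic_norm x < real p ^ n"
      using real_arch_pow[OF p_gt_1] by blast
    then show ?thesis
      using p_gt_1 by (intro exI[of _ n]) (simp add: powr_realpow)
  qed
  then have "\<Union>(range ?B) = space M"
    by auto
  moreover have "emeasure M (?B n) \<noteq> \<infinity>" for n
    by (simp only: emeasure_ball) simp
  moreover have "?B n \<in> sets M" for n
    by measurable
  ultimately show "\<exists>A. countable A \<and> A \<subseteq> sets M \<and> \<Union> A = space M \<and> (\<forall>a\<in>A. emeasure M a \<noteq> \<infinity>)"
    by (intro exI[of _ "range ?B"]) (auto simp only: intro!: countable_image)
qed

text \<open>Spheres partition the nonzero elements, and for nonnegative functions the sum over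
  spheres commutes with the integral.\<close>

lemma radial_nn_integral:
  fixes g :: "'p padic \<Rightarrow> ennreal" and h :: "int \<Rightarrow> ennreal"
  assumes g: "\<And>k x. x \<in> padic_sphere k \<Longrightarrow> g x = h k"
  shows "(\<integral>\<^sup>+x\<in>-{0}. g x \<partial>M) =
    (\<integral>\<^sup>+k. h k * ennreal ((1 - 1 / real p) * real p powr real_of_int k) \<partial>count_space UNIV)"
proof -
  \<comment> \<open>For fixed \<open>x\<close> at most one \<open>k\<close> contributes; at
    \<open>x = 0\<close> none does, matching the indicator.\<close>
  have "g x * indicator (- {0}) x = (\<integral>\<^sup>+k. h k * indicator (padic_sphere k) x \<partial>count_space UNIV)" for x
  proof (cases "x = 0")
    case True
    then show ?thesis
      using sphere_nonzero[of "0 :: 'p padic"] by (auto simp: nn_integral_0_iff_AE indicator_eq_0_iff)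
  next
    case False
    then obtain l where l: "x \<in> padic_sphere l"
      by (rule sphere_exists)
    have "h k * indicator (padic_sphere k) x = h l * indicator {l} k" for k
      using sphere_unique[OF l, of k] by (auto simp: indicator_def)
    then show ?thesis
      using False g[OF l] by (simp add: nn_integral_cmult_indicator)
  qed
  then have "(\<integral>\<^sup>+x\<in>-{0}. g x \<partial>M) =
      (\<integral>\<^sup>+x. (\<integral>\<^sup>+k. h k * indicator (padic_sphere k) x \<partial>count_space UNIV) \<partial>M)"
    by simp
  also have "\<dots> = (\<integral>\<^sup>+k. (\<integral>\<^sup>+x. h k * indicator (padic_sphere k) x \<partial>M) \<partial>count_space UNIV)"
    by (rule nn_integral_count_space_nn_integral) auto
  also have "\<dots> = (\<integral>\<^sup>+k. h k * ennreal ((1 - 1 / real p) * real p powr real_of_int k) \<partial>count_space UNIV)"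
    by (simp add: nn_integral_cmult_indicator emeasure_sphere)
  finally show ?thesis .
qed

end

section \<open>Jensen's inequality and sums over \<open>\<int>\<close>\<close>

text \<open>A convex function lies above its tangents. The derivative argument lives on the open
  half-line, so \<open>t = 0\<close> and \<open>g = 0\<close> are treated by hand.\<close>

lemma powr_above_tangent:
  fixes g t q :: real
  assumes "0 \<le> g" "0 \<le> t" "1 \<le> q"
  shows "t powr q + q * t powr (q - 1) * (g - t) \<le> g powr q"
proof (cases "t = 0")
  case True
  \<comment> \<open>The left side is \<open>0\<close>, even for \<open>q = 1\<close>, as
    \<open>0 powr 0 = 0\<close>.\<close>
  then show ?thesis by simp
next
  case False
  with assms have t: "t > 0" by simp
  show ?thesis
  proof (cases "g = 0")
    case True
    have "t powr (q - 1) * t = t powr q"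
      using t by (simp add: powr_diff)
    then have "t powr q + q * t powr (q - 1) * (g - t) = (1 - q) * t powr q"
      using True by (simp add: algebra_simps)
    also have "\<dots> \<le> 0"
      using assms by (intro mult_nonpos_nonneg) auto
    finally show ?thesis
      using True by simp
  next
    case False
    have "q * t powr (q - 1) * (g - t) \<le> g powr q - t powr q"
      using powr_convex[OF assms(3)] t assms False
      by (intro convex_on_imp_above_tangent[where A = "{0<..}"])
         (auto intro!: derivative_eq_intros simp: interior_open)
    then show ?thesis by simp
  qed
qed

text \<open>Jensen for the measure with density \<open>\<kappa>\<close>; its total mass
  \<open>m\<close> need not be 1, whence the factor \<open>m powr (q - 1)\<close>. The tangent at
  the mean \<open>t = s / m\<close> is integrated against \<open>\<kappa>\<close>, which covers
  \<open>q = 1\<close> too.\<close>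

lemma jensen_powr:
  fixes \<kappa> g :: "'a \<Rightarrow> real" and q :: real
  assumes [measurable]: "g \<in> borel_measurable M"
    and \<kappa>: "\<And>x. 0 \<le> \<kappa> x" and g: "\<And>x. 0 \<le> g x" and q: "1 \<le> q"
    and int_\<kappa>: "integrable M \<kappa>" and int_q: "integrable M (\<lambda>x. \<kappa> x * g x powr q)"
  shows "integrable M (\<lambda>x. \<kappa> x * g x)"
    and "(LINT x|M. \<kappa> x * g x) powr q \<le> (LINT x|M. \<kappa> x) powr (q - 1) * (LINT x|M. \<kappa> x * g x powr q)"
proof -
  have [measurable]: "\<kappa> \<in> borel_measurable M"
    using int_\<kappa> by (rule borel_measurable_integrable)
  \<comment> \<open>This deduces integrability of \<open>\<kappa> x * g x\<close> from the two
    integrability hypotheses.\<close>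
  have g_le: "g x \<le> 1 + g x powr q" for x
  proof (cases "g x \<le> 1")
    case False
    then have "g x powr 1 \<le> g x powr q"
      using q by (intro powr_mono) auto
    then show ?thesis using False by simp
  qed (simp add: add_increasing2)
  show int_g: "integrable M (\<lambda>x. \<kappa> x * g x)"
  proof (rule Bochner_Integration.integrable_bound)
    show "integrable M (\<lambda>x. \<kappa> x + \<kappa> x * g x powr q)"
      by (intro Bochner_Integration.integrable_add int_\<kappa> int_q)
    have "\<bar>\<kappa> x * g x\<bar> \<le> \<bar>\<kappa> x + \<kappa> x * g x powr q\<bar>" for x
      using mult_left_mono[OF g_le \<kappa>, of x x] \<kappa>[of x] g[of x]
      by (simp add: distrib_left abs_mult)
    then show "AE x in M. norm (\<kappa> x * g x) \<le> norm (\<kappa> x + \<kappa> x * g x powr q)"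
      by simp
  qed measurable
  define m where "m = (LINT x|M. \<kappa> x)"
  define s where "s = (LINT x|M. \<kappa> x * g x)"
  define t where "t = s / m"
  have m: "m \<ge> 0" and s: "s \<ge> 0"
    unfolding m_def s_def using \<kappa> g by (auto intro!: Bochner_Integration.integral_nonneg)
  show "s powr q \<le> m powr (q - 1) * (LINT x|M. \<kappa> x * g x powr q)"
  proof (cases "m = 0")
    case True
    then have "AE x in M. \<kappa> x = 0"
      using integral_nonneg_eq_0_iff_AE[OF int_\<kappa>] \<kappa> by (simp add: m_def)
    then have "s = 0"
      unfolding s_def by (intro integral_eq_zero_AE) auto
    then show ?thesis
      using True q by simp
  next
    case False
    with m have m: "m > 0" by simp
    have t: "t \<ge> 0"
      using m s by (simp add: t_def)
    have st: "s = t * m"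
      using m by (simp add: t_def)
    \<comment> \<open>The linear term of the tangent integrates to zero because
      \<open>s = t * m\<close>.\<close>
    have "m * t powr q = (LINT x|M. \<kappa> x * (t powr q - q * t powr (q - 1) * t) + q * t powr (q - 1) * (\<kappa> x * g x))"
      using int_\<kappa> int_g by (simp add: m_def[symmetric] s_def[symmetric]) (simp add: st algebra_simps)
    also have "\<dots> \<le> (LINT x|M. \<kappa> x * g x powr q)"
    proof (rule Bochner_Integration.integral_mono[OF _ int_q])
      show "integrable M (\<lambda>x. \<kappa> x * (t powr q - q * t powr (q - 1) * t) + q * t powr (q - 1) * (\<kappa> x * g x))"
        using int_\<kappa> int_g by simp
      show "\<kappa> x * (t powr q - q * t powr (q - 1) * t) + q * t powr (q - 1) * (\<kappa> x * g x) \<le> \<kappa> x * g x powr q" for x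
        using mult_left_mono[OF powr_above_tangent[OF g t q] \<kappa>, of x x] by (simp add: algebra_simps)
    qed
    finally have "m powr (q - 1) * (m * t powr q) \<le> m powr (q - 1) * (LINT x|M. \<kappa> x * g x powr q)"
      by (intro mult_left_mono) auto
    moreover have "m powr (q - 1) * (m * t powr q) = s powr q"
      unfolding st using m t by (simp add: powr_mult powr_diff)
    ultimately show ?thesis
      by simp
  qed
qed

text \<open>The index \<open>0\<close> is counted in the left half, so the right geometric series
  starts with \<open>s\<close>.\<close>

lemma nn_integral_two_sided_geometric:
  fixes r s :: real
  assumes "0 \<le> r" "r < 1" "0 \<le> s" "s < 1"
  shows "(\<integral>\<^sup>+n. ennreal (if n \<le> 0 then r ^ nat (- n) else s ^ nat n) \<partial>count_space (UNIV :: int set))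
           = ennreal (1 / (1 - r) + s / (1 - s))" (is "(\<integral>\<^sup>+n. ?f n \<partial>_) = _")
proof -
  have "(\<integral>\<^sup>+n. ?f n \<partial>count_space UNIV)
      = (\<integral>\<^sup>+n. ?f n * indicator {..0} n + ?f n * indicator {0<..} n \<partial>count_space UNIV)"
    by (intro nn_integral_cong) (auto simp: indicator_def)
  also have "\<dots> = (\<integral>\<^sup>+n. ?f n * indicator {..0} n \<partial>count_space UNIV)
      + (\<integral>\<^sup>+n. ?f n * indicator {0<..} n \<partial>count_space UNIV)"
    by (rule nn_integral_add) auto
  also have "(\<integral>\<^sup>+n. ?f n * indicator {..0} n \<partial>count_space UNIV) = (\<integral>\<^sup>+n. ?f n \<partial>count_space {..0})"
    by (simp add: nn_integral_count_space_indicator)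
  also have "\<dots> = (\<integral>\<^sup>+n. ?f (- int n) \<partial>count_space UNIV)"
    by (rule nn_integral_bij_count_space[symmetric])
       (rule bij_betwI[where g = "\<lambda>n. nat (- n)"], auto)
  also have "\<dots> = (\<Sum>n. ennreal (r ^ n))"
    by (simp add: nn_integral_count_space_nat)
  also have "\<dots> = ennreal (1 / (1 - r))"
    using assms by (intro suminf_ennreal_eq geometric_sums) auto
  also have "(\<integral>\<^sup>+n. ?f n * indicator {0<..} n \<partial>count_space UNIV) = (\<integral>\<^sup>+n. ?f n \<partial>count_space {0<..})"
    by (simp add: nn_integral_count_space_indicator)
  also have "\<dots> = (\<integral>\<^sup>+n. ?f (int n + 1) \<partial>count_space UNIV)"
    by (rule nn_integral_bij_count_space[symmetric])
       (rule bij_betwI[where g = "\<lambda>n. nat (n - 1)"], auto)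
  also have "\<dots> = (\<Sum>n. ennreal (s * s ^ n))"
    by (simp add: nn_integral_count_space_nat nat_add_distrib)
  also have "\<dots> = ennreal (s / (1 - s))"
    using assms sums_mult[OF geometric_sums[of s], of s] by (intro suminf_ennreal_eq) auto
  finally show ?thesis
    using assms by simp
qed

text \<open>Translations and reflections permute the integers; this gives columns and rows of a
  convolution matrix the same sum.\<close>

lemma nn_integral_count_space_int_diff:
  fixes f :: "int \<Rightarrow> ennreal"
  shows "(\<integral>\<^sup>+k. f (k - j) \<partial>count_space UNIV) = (\<integral>\<^sup>+n. f n \<partial>count_space UNIV)"
    and "(\<integral>\<^sup>+k. f (j - k) \<partial>count_space UNIV) = (\<integral>\<^sup>+n. f n \<partial>count_space UNIV)"
  by (rule nn_integral_bij_count_space, rule bij_betwI[where g = "\<lambda>n. n + j"], auto)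
     (rule nn_integral_bij_count_space, rule bij_betwI[where g = "\<lambda>n. j - n"], auto)

section \<open>Sums over finite index sets and integrals of radial functions\<close>

lemma nn_integral_indicator_count_space:
  fixes h :: "'a \<Rightarrow> real"
  assumes "finite I" "\<And>k. 0 \<le> h k"
  shows "(\<integral>\<^sup>+k. ennreal (indicator I k * h k) \<partial>count_space UNIV) = ennreal (\<Sum>k\<in>I. h k)"
proof -
  have "(\<integral>\<^sup>+k. ennreal (indicator I k * h k) \<partial>count_space UNIV) = (\<integral>\<^sup>+k. ennreal (h k) \<partial>count_space I)"
    by (subst nn_integral_count_space_indicator) (auto intro!: nn_integral_cong simp: indicator_def)
  also have "\<dots> = ennreal (\<Sum>k\<in>I. h k)"
    using assms by (simp add: nn_integral_count_space_finite)
  finally show ?thesis .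
qed

text \<open>The factor \<open>p powr k\<close> of the sphere measure sits in the hypothesis, so that
  each application reduces to an identity of exponents; \<open>a\<close> collects what is common to
  all spheres.\<close>

lemma (in padic_haar) radial_nn_integral_real:
  fixes u :: "'p padic \<Rightarrow> real" and b :: "int \<Rightarrow> real"
  assumes u: "\<And>k x. x \<in> padic_sphere k \<Longrightarrow> u x * real p powr real_of_int k = a * b k"
    and a: "0 \<le> a" and b: "\<And>k. 0 \<le> b k"
  shows "(\<integral>\<^sup>+x\<in>-{0}. ennreal (u x) \<partial>M) =
    ennreal a * (ennreal (1 - 1 / real p) * (\<integral>\<^sup>+k. ennreal (b k) \<partial>count_space UNIV))"
proof -
  define h where "h k = a * b k / real p powr real_of_int k" for k
  have "u x = h k" if "x \<in> padic_sphere k" for x k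
    using u[OF that] p_gt_1 by (simp add: h_def divide_simps)
  then have "(\<integral>\<^sup>+x\<in>-{0}. ennreal (u x) \<partial>M) =
      (\<integral>\<^sup>+k. ennreal (h k) * ennreal ((1 - 1 / real p) * real p powr real_of_int k) \<partial>count_space UNIV)"
    by (intro radial_nn_integral) simp
  also have "\<dots> = (\<integral>\<^sup>+k. ennreal a * (ennreal (1 - 1 / real p) * ennreal (b k)) \<partial>count_space UNIV)"
    using p_gt_1 a b
    by (intro nn_integral_cong) (simp add: h_def ennreal_mult[symmetric])
  also have "\<dots> = ennreal a * (ennreal (1 - 1 / real p) * (\<integral>\<^sup>+k. ennreal (b k) \<partial>count_space UNIV))"
    by (simp add: nn_integral_cmult)
  finally show ?thesis .
qed

lemma (in padic_haar) set_integral_of_nn_integral: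
  fixes u :: "'p padic \<Rightarrow> real"
  assumes [measurable]: "u \<in> borel_measurable M" and "\<And>x. 0 \<le> u x" "0 \<le> r"
    and "(\<integral>\<^sup>+x\<in>-{0}. ennreal (u x) \<partial>M) = ennreal r"
  shows "set_integrable M (- {0}) u" and "(LINT x:- {0}|M. u x) = r"
proof -
  have [measurable]: "- {0} \<in> sets M"
    using borel_closed[of "{0 :: 'p padic}"] sets_M by auto
  have "(\<integral>\<^sup>+x. ennreal (indicator (- {0}) x *\<^sub>R u x) \<partial>M) = ennreal r"
    unfolding assms(4)[symmetric] by (intro nn_integral_cong) (simp add: indicator_def)
  then show "set_integrable M (- {0}) u" "(LINT x:- {0}|M. u x) = r"
    unfolding set_integrable_def set_lebesgue_integral_def using assms(2,3)
    by (auto intro!: integrableI_nn_integral_finite simp: integral_eq_nn_integral)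
qed

section \<open>The matrix of the operator on radial functions\<close>

locale padic_hardy = padic_haar M p
  for M :: "'p::prime_card padic measure" and p :: nat +
  fixes q lam \<mu> \<nu> \<alpha> \<beta> :: real
  assumes q_ge_1: "1 \<le> q"
begin

definition A :: real where "A = \<mu> + 1 - (\<alpha> + 1) / q"
definition B :: real where "B = \<nu> + (\<beta> + 1) / q"

definition G :: "int \<Rightarrow> int \<Rightarrow> real" where
  "G k j = real p powr (k * A + j * B - lam * max k j)"

definition hardy_const :: real where
  "hardy_const = (1 - 1 / real p) * (1 + 1 / (real p powr A - 1) + 1 / (real p powr B - 1))"

abbreviation w :: "'p padic \<Rightarrow> real" where
  "w x \<equiv> padic_norm x powr (- (\<alpha> + 1) / q)"

lemma one_minus_inverse_p_pos: "0 < 1 - 1 / real p"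
  using p_gt_1 by simp

lemma G_pos: "0 < G k j"
  using p_gt_1 by (simp add: G_def)

lemma H_kernel_nonneg: "0 \<le> H_kernel lam \<mu> \<nu> x y"
  by (simp add: H_kernel_def)

lemma H_kernel_sphere:
  fixes x y :: "'p padic"
  assumes "x \<in> padic_sphere k" "y \<in> padic_sphere j"
  shows "H_kernel lam \<mu> \<nu> x y = real p powr (k * \<mu> + j * \<nu> - lam * max k j)"
proof -
  have "max (real p powr k) (real p powr j) = real p powr max k j"
    using p_gt_1 by (auto simp: max_def)
  then show ?thesis
    using assms p_gt_1
    by (simp add: H_kernel_def padic_norm_sphere powr_powr powr_add powr_diff mult.commute)
qed

text \<open>This is where \<open>G\<close> arises: \<open>A\<close> gathers the exponents attached
  to \<open>k\<close>, including the 1 from the sphere measure, and \<open>B\<close> those attached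
  to \<open>j\<close> once the weight in \<open>y\<close> is split off.\<close>

lemma kernel_sphere_w:
  fixes x y :: "'p padic"
  assumes "x \<in> padic_sphere k" "y \<in> padic_sphere j"
  shows "H_kernel lam \<mu> \<nu> x y * w x * real p powr k = padic_norm y powr (- (\<beta> + 1) / q) * G k j"
  unfolding H_kernel_sphere[OF assms] padic_norm_sphere[OF assms(1)] padic_norm_sphere[OF assms(2)]
    powr_powr powr_add[symmetric] G_def
  by (rule arg_cong[where f = "(powr) (real p)"])
     (use q_ge_1 in \<open>simp add: A_def B_def field_simps\<close>)

text \<open>The exponent \<open>(\<beta> + 1) / q - 1\<close> is chosen so that the same
  \<open>G\<close> appears, now to be summed over \<open>j\<close>.\<close>

lemma kernel_sphere_dual:
  fixes x y :: "'p padic"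
  assumes "x \<in> padic_sphere k" "y \<in> padic_sphere j"
  shows "H_kernel lam \<mu> \<nu> x y * padic_norm y powr ((\<beta> + 1) / q - 1) * real p powr j
           = padic_norm x powr ((\<alpha> + 1) / q - 1) * G k j"
  unfolding H_kernel_sphere[OF assms] padic_norm_sphere[OF assms(1)] padic_norm_sphere[OF assms(2)]
    powr_powr powr_add[symmetric] G_def
  by (rule arg_cong[where f = "(powr) (real p)"])
     (use q_ge_1 in \<open>simp add: A_def B_def field_simps\<close>)

text \<open>The exponent of \<open>G k j\<close> collapses to \<open>- A (j - k)\<close> for
  \<open>k \<le> j\<close> and to \<open>- B (k - j)\<close> otherwise.\<close>

lemma G_eq_convolution:
  assumes "lam = A + B"
  shows "G k j = (if k - j \<le> 0 then (real p powr - A) ^ nat (- (k - j)) else (real p powr - B) ^ nat (k - j))"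
proof -
  have *: "(real p powr a) ^ n = real p powr (a * n)" for a n
    using p_gt_1 by (simp add: powr_realpow[symmetric] powr_powr)
  have "k * A + j * B - lam * max (real_of_int k) (real_of_int j) = (if k - j \<le> 0 then - A * nat (- (k - j)) else - B * nat (k - j))"
    by (simp add: assms max_def algebra_simps)
  then show ?thesis
    by (simp only: * G_def if_distrib[of "(powr) (real p)"])
qed

lemma hardy_const_pos:
  assumes "0 < A" "0 < B"
  shows "0 < hardy_const"
  using assms p_gt_1 one_minus_inverse_p_pos unfolding hardy_const_def
  by (intro mult_pos_pos add_pos_pos) auto

text \<open>Row and column sums of a convolution agree; here they are a two-sided geometric series
  with ratios \<open>p powr - A\<close> and \<open>p powr - B\<close>.\<close>

lemma G_sums:
  assumes "lam = A + B" "0 < A" "0 < B"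
  shows "ennreal (1 - 1 / real p) * (\<integral>\<^sup>+k. ennreal (G k j) \<partial>count_space UNIV) = ennreal hardy_const"
    and "ennreal (1 - 1 / real p) * (\<integral>\<^sup>+k. ennreal (G j k) \<partial>count_space UNIV) = ennreal hardy_const"
proof -
  define f where "f = (\<lambda>n::int. ennreal (if n \<le> 0 then (real p powr - A) ^ nat (- n) else (real p powr - B) ^ nat n))"
  have lt: "real p powr - A < 1" "real p powr - B < 1"
    using assms p_gt_1 by (simp_all add: powr_less_one)
  have f: "ennreal (G k j) = f (k - j)" for k j
    by (simp only: f_def G_eq_convolution[OF assms(1)])
  have gt: "1 < real p powr A" "1 < real p powr B"
    using assms p_gt_1 by simp_all
  have "(\<integral>\<^sup>+n. f n \<partial>count_space UNIV) =
      ennreal (1 / (1 - real p powr - A) + real p powr - B / (1 - real p powr - B))"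
    unfolding f_def by (rule nn_integral_two_sided_geometric) (use lt in auto)
  \<comment> \<open>Uses \<open>1 / (1 - r) = 1 + 1 / (1 / r - 1)\<close> and
    \<open>s / (1 - s) = 1 / (1 / s - 1)\<close>; the summand 1 is the diagonal term.\<close>
  also have "1 / (1 - real p powr - A) + real p powr - B / (1 - real p powr - B)
      = 1 + 1 / (real p powr A - 1) + 1 / (real p powr B - 1)"
    using gt p_gt_1 assms by (simp add: powr_minus divide_simps)
  finally have "ennreal (1 - 1 / real p) * (\<integral>\<^sup>+n. f n \<partial>count_space UNIV) = ennreal hardy_const"
    unfolding hardy_const_def using one_minus_inverse_p_pos by (simp add: ennreal_mult')
  then show "ennreal (1 - 1 / real p) * (\<integral>\<^sup>+k. ennreal (G k j) \<partial>count_space UNIV) = ennreal hardy_const"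
    and "ennreal (1 - 1 / real p) * (\<integral>\<^sup>+k. ennreal (G j k) \<partial>count_space UNIV) = ennreal hardy_const"
    by (simp_all only: f nn_integral_count_space_int_diff)
qed

text \<open>First Schur condition: all columns of \<open>G\<close> have the same sum, so the
  operator turns \<open>w\<close> into a multiple of the target weight.\<close>

lemma kernel_integral:
  assumes "lam = A + B" "0 < A" "0 < B" and y: "y \<noteq> 0"
  shows "(\<integral>\<^sup>+x\<in>-{0}. ennreal (H_kernel lam \<mu> \<nu> x y * w x) \<partial>M) = ennreal (hardy_const * padic_norm y powr (- (\<beta> + 1) / q))"
proof -
  obtain j where j: "y \<in> padic_sphere j"
    using sphere_exists[OF y] .
  have "(\<integral>\<^sup>+x\<in>-{0}. ennreal (H_kernel lam \<mu> \<nu> x y * w x) \<partial>M) = ennreal (padic_norm y powr (- (\<beta> + 1) / q)) *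
      (ennreal (1 - 1 / real p) * (\<integral>\<^sup>+k. ennreal (G k j) \<partial>count_space UNIV))"
    by (intro radial_nn_integral_real kernel_sphere_w j) (auto simp: G_pos less_imp_le)
  then show ?thesis
    using hardy_const_pos[OF assms(2,3)] G_sums(1)[OF assms(1-3)] by (simp add: ennreal_mult mult.commute)
qed

text \<open>Second Schur condition, from the row sums.\<close>

lemma kernel_integral_dual:
  assumes "lam = A + B" "0 < A" "0 < B" and x: "x \<noteq> 0"
  shows "(\<integral>\<^sup>+y\<in>-{0}. ennreal (H_kernel lam \<mu> \<nu> x y * padic_norm y powr ((\<beta> + 1) / q - 1)) \<partial>M) =
           ennreal (hardy_const * padic_norm x powr ((\<alpha> + 1) / q - 1))"
proof -
  obtain k where k: "x \<in> padic_sphere k"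
    using sphere_exists[OF x] .
  have "(\<integral>\<^sup>+y\<in>-{0}. ennreal (H_kernel lam \<mu> \<nu> x y * padic_norm y powr ((\<beta> + 1) / q - 1)) \<partial>M) =
      ennreal (padic_norm x powr ((\<alpha> + 1) / q - 1)) *
      (ennreal (1 - 1 / real p) * (\<integral>\<^sup>+j. ennreal (G k j) \<partial>count_space UNIV))"
    by (intro radial_nn_integral_real kernel_sphere_dual k) (auto simp: G_pos less_imp_le)
  then show ?thesis
    using hardy_const_pos[OF assms(2,3)] G_sums(2)[OF assms(1-3)] by (simp add: ennreal_mult mult.commute)
qed

section \<open>The upper bound\<close>

lemma measurable_H_kernel [measurable]:
  "(\<lambda>(x, y). H_kernel lam \<mu> \<nu> x y) \<in> borel_measurable (M \<Otimes>\<^sub>M M)"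
  unfolding H_kernel_def by measurable

lemma measurable_H_kernel_left [measurable]: "(\<lambda>x. H_kernel lam \<mu> \<nu> x y) \<in> borel_measurable M"
  unfolding H_kernel_def by measurable

text \<open>Valid for every \<open>\<mu>\<close> because \<open>0 powr a = 0\<close>; it lets
  integrals over \<open>- {0}\<close> pass to the whole field.\<close>

lemma H_kernel_0_left [simp]: "H_kernel lam \<mu> \<nu> 0 y = 0"
  by (simp add: H_kernel_def)

lemma H_op_eq: "H_op M lam \<mu> \<nu> f y = (LINT x|M. H_kernel lam \<mu> \<nu> x y * (indicator (- {0}) x * f x))"
  by (simp add: H_op_def set_lebesgue_integral_def mult.left_commute)

lemma measurable_H_op:
  assumes "set_borel_measurable M (- {0}) f"
  shows "H_op M lam \<mu> \<nu> f \<in> borel_measurable M"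
proof -
  interpret sigma_finite_measure M
    by (rule sigma_finite_M)
  have [measurable]: "(\<lambda>x. indicator (- {0}) x * f x) \<in> borel_measurable M"
    using assms by (simp add: set_borel_measurable_def)
  show ?thesis
    unfolding H_op_eq[abs_def] by measurable
qed

text \<open>Jensen in \<open>x\<close> against the kernel weighted by \<open>w\<close> contributes
  \<open>hardy_const powr (q - 1)\<close>; exchanging the integrals and the second Schur condition
  contribute one more factor \<open>hardy_const\<close>. The \<open>q\<close>-th root leaves
  \<open>hardy_const\<close>.\<close>

lemma schur_test:
  assumes hom: "lam = A + B" "0 < A" "0 < B" and f: "f \<in> Lq_space M q \<alpha>"
  shows "AE y in M. y \<noteq> 0 \<longrightarrow> set_integrable M (- {0}) (\<lambda>x. H_kernel lam \<mu> \<nu> x y * f x)"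
    and "H_op M lam \<mu> \<nu> f \<in> Lq_space M q \<beta>"
    and "Lq_norm M q \<beta> (H_op M lam \<mu> \<nu> f) \<le> hardy_const * Lq_norm M q \<alpha> f"
proof -
  interpret M: sigma_finite_measure M
    by (rule sigma_finite_M)
  interpret MM: pair_sigma_finite M M ..
  have Npos: "0 < hardy_const"
    by (rule hardy_const_pos[OF hom(2,3)])
  define f' where "f' x = indicator (- {0}) x * f x" for x
  have fm: "set_borel_measurable M (- {0}) f"
    and fi: "set_integrable M (- {0}) (\<lambda>x. \<bar>f x\<bar> powr q * padic_norm x powr \<alpha>)"
    using f by (auto simp: Lq_space_def)
  have [measurable]: "f' \<in> borel_measurable M"
    using fm by (simp add: set_borel_measurable_def f'_def[abs_def])
  define I where "I = (LINT x:- {0}|M. \<bar>f x\<bar> powr q * padic_norm x powr \<alpha>)"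
  have I: "(\<integral>\<^sup>+x. ennreal (\<bar>f' x\<bar> powr q * padic_norm x powr \<alpha>) \<partial>M) = ennreal I"
  proof -
    have eq: "\<bar>f' x\<bar> powr q * padic_norm x powr \<alpha> = indicator (- {0}) x *\<^sub>R (\<bar>f x\<bar> powr q * padic_norm x powr \<alpha>)" for x
      by (simp add: f'_def indicator_def)
    show ?thesis
      unfolding eq I_def set_lebesgue_integral_def
      using fi by (intro nn_integral_eq_integral) (auto simp: set_integrable_def)
  qed
  have I0: "0 \<le> I"
    unfolding I_def set_lebesgue_integral_def by (intro Bochner_Integration.integral_nonneg) simp
  \<comment> \<open>Splitting the integrand as \<open>\<kappa> y x * g x\<close> puts
    \<open>w\<close> into the measure, whose mass is then known from
    \<open>kernel_integral\<close>.\<close>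
  define \<kappa> where "\<kappa> y x = H_kernel lam \<mu> \<nu> x y * w x" for x y
  define g where "g x = \<bar>f' x\<bar> / w x" for x
  \<comment> \<open>The power of \<open>padic_norm y\<close> left after Jensen,
    \<open>\<beta> - (\<beta> + 1) (q - 1) / q\<close>; it is the weight in
    \<open>kernel_integral_dual\<close>.\<close>
  define b where "b = (\<beta> + 1) / q - 1"
  define \<Phi> where "\<Phi> y = (\<integral>\<^sup>+x. ennreal (\<kappa> y x * g x powr q) \<partial>M)" for y
  have [measurable]: "g \<in> borel_measurable M"
    unfolding g_def[abs_def] by measurable
  have [measurable]: "(\<lambda>(y, x). \<kappa> y x) \<in> borel_measurable (M \<Otimes>\<^sub>M M)"
    unfolding \<kappa>_def H_kernel_def by measurable
  have [measurable]: "\<kappa> y \<in> borel_measurable M" for y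
    unfolding \<kappa>_def[abs_def] by measurable
  have [measurable]: "\<Phi> \<in> borel_measurable M"
    unfolding \<Phi>_def[abs_def] by measurable
  have \<kappa>0: "0 \<le> \<kappa> y x" and g0: "0 \<le> g x" for x y
    by (simp_all add: \<kappa>_def g_def H_kernel_nonneg)
  have wpos: "0 < w x" if "x \<noteq> 0" for x
    using padic_norm_pos[OF that] by simp
  have \<kappa>g: "\<kappa> y x * g x = H_kernel lam \<mu> \<nu> x y * \<bar>f' x\<bar>" for x y
    using wpos[of x] by (cases "x = 0") (simp_all add: \<kappa>_def g_def)

  \<comment> \<open>Tonelli: for fixed \<open>x\<close> the integral in \<open>y\<close> is the
    second Schur condition, and the powers of \<open>padic_norm x\<close> combine to
    \<open>\<alpha>\<close>.\<close>
  have swap: "(\<integral>\<^sup>+y\<in>-{0}. ennreal (padic_norm y powr b) * \<Phi> y \<partial>M) = ennreal (hardy_const * I)"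
  proof -
    have "(\<integral>\<^sup>+y\<in>-{0}. ennreal (padic_norm y powr b) * \<Phi> y \<partial>M) =
        (\<integral>\<^sup>+y. \<integral>\<^sup>+x. ennreal (indicator (- {0}) y * padic_norm y powr b) * ennreal (\<kappa> y x * g x powr q) \<partial>M \<partial>M)"
      unfolding \<Phi>_def
      by (subst nn_integral_cmult) (auto intro!: nn_integral_cong simp: indicator_def)
    also have "\<dots> = (\<integral>\<^sup>+x. \<integral>\<^sup>+y. ennreal (indicator (- {0}) y * padic_norm y powr b) * ennreal (\<kappa> y x * g x powr q) \<partial>M \<partial>M)"
      by (rule MM.Fubini'[symmetric]) measurable
    also have "\<dots> = (\<integral>\<^sup>+x. ennreal hardy_const * ennreal (\<bar>f' x\<bar> powr q * padic_norm x powr \<alpha>) \<partial>M)"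
    proof (intro nn_integral_cong)
      fix x :: "'p padic"
      show "(\<integral>\<^sup>+y. ennreal (indicator (- {0}) y * padic_norm y powr b) * ennreal (\<kappa> y x * g x powr q) \<partial>M)
          = ennreal hardy_const * ennreal (\<bar>f' x\<bar> powr q * padic_norm x powr \<alpha>)"
      proof (cases "x = 0")
        case True
        then show ?thesis
          by (simp add: \<kappa>_def)
      next
        case False
        let ?n = "padic_norm x"
        have n: "0 < ?n"
          by (rule padic_norm_pos[OF False])
        have gq: "g x powr q = \<bar>f' x\<bar> powr q * ?n powr (\<alpha> + 1)"
        proof -
          have "g x = \<bar>f' x\<bar> * ?n powr ((\<alpha> + 1) / q)"
            unfolding g_def minus_divide_left[symmetric] powr_minus
            by (simp only: divide_inverse inverse_inverse_eq)
          then show ?thesis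
            using q_ge_1 by (simp add: powr_mult powr_powr)
        qed
        have "(\<integral>\<^sup>+y. ennreal (indicator (- {0}) y * padic_norm y powr b) * ennreal (\<kappa> y x * g x powr q) \<partial>M)
            = (\<integral>\<^sup>+y. ennreal (w x * g x powr q) * (ennreal (H_kernel lam \<mu> \<nu> x y * padic_norm y powr b) * indicator (- {0}) y) \<partial>M)"
          by (intro nn_integral_cong)
             (auto simp: \<kappa>_def ennreal_mult[symmetric] H_kernel_nonneg indicator_def ac_simps)
        also have "\<dots> = ennreal (w x * g x powr q) * ennreal (hardy_const * ?n powr ((\<alpha> + 1) / q - 1))"
          unfolding b_def kernel_integral_dual[OF hom False, symmetric]
          by (rule nn_integral_cmult) (unfold H_kernel_def, measurable)
        also have "\<dots> = ennreal (hardy_const * (\<bar>f' x\<bar> powr q * (w x * ?n powr (\<alpha> + 1) * ?n powr ((\<alpha> + 1) / q - 1))))"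
          using Npos by (simp add: gq ennreal_mult[symmetric] ac_simps)
        also have "w x * ?n powr (\<alpha> + 1) * ?n powr ((\<alpha> + 1) / q - 1) = ?n powr \<alpha>"
          unfolding powr_add[symmetric] by (rule arg_cong[where f = "(powr) ?n"]) (use q_ge_1 in \<open>simp add: field_simps\<close>)
        finally show ?thesis
          using Npos by (simp add: ennreal_mult)
      qed
    qed
    also have "\<dots> = ennreal (hardy_const * I)"
      using Npos I0 by (subst nn_integral_cmult) (auto simp: I ennreal_mult[of hardy_const I])
    finally show ?thesis .
  qed

  \<comment> \<open>Finiteness of \<open>\<Phi> y\<close> supplies the integrability that Jensen
    requires; \<open>swap\<close> will give it almost everywhere.\<close>
  have pointwise: "set_integrable M (- {0}) (\<lambda>x. H_kernel lam \<mu> \<nu> x y * f x) \<and>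
      ennreal (\<bar>H_op M lam \<mu> \<nu> f y\<bar> powr q * padic_norm y powr \<beta>) \<le> ennreal (hardy_const powr (q - 1)) * (ennreal (padic_norm y powr b) * \<Phi> y)"
    if y: "y \<noteq> 0" and fin: "\<Phi> y \<noteq> \<infinity>" for y
  proof -
    let ?m = "hardy_const * padic_norm y powr (- (\<beta> + 1) / q)"
    have ypos: "0 < padic_norm y"
      by (rule padic_norm_pos[OF y])
    have "(\<integral>\<^sup>+x. ennreal (\<kappa> y x) \<partial>M) = ennreal ?m"
      unfolding kernel_integral[OF hom y, symmetric]
      by (intro nn_integral_cong) (auto simp: \<kappa>_def indicator_def)
    then have int_\<kappa>: "integrable M (\<kappa> y)" and m: "(LINT x|M. \<kappa> y x) = ?m"
      using \<kappa>0 Npos by (auto intro!: integrableI_nn_integral_finite simp: integral_eq_nn_integral)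
    have int_q: "integrable M (\<lambda>x. \<kappa> y x * g x powr q)"
      using fin \<kappa>0 by (intro integrableI_nonneg) (auto simp: \<Phi>_def top.not_eq_extremum)
    have \<Phi>: "\<Phi> y = ennreal (LINT x|M. \<kappa> y x * g x powr q)"
      unfolding \<Phi>_def using \<kappa>0 by (intro nn_integral_eq_integral int_q) simp
    note J = jensen_powr[OF _ \<kappa>0 g0 q_ge_1 int_\<kappa> int_q, simplified \<kappa>g m]
    have int: "integrable M (\<lambda>x. H_kernel lam \<mu> \<nu> x y * \<bar>f' x\<bar>)"
      by (rule J(1)) measurable
    have "integrable M (\<lambda>x. H_kernel lam \<mu> \<nu> x y * f' x)"
      by (rule Bochner_Integration.integrable_bound[OF int]) (auto simp: abs_mult)
    then have 1: "set_integrable M (- {0}) (\<lambda>x. H_kernel lam \<mu> \<nu> x y * f x)"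
      by (simp add: set_integrable_def f'_def mult.left_commute)
    have "\<bar>H_op M lam \<mu> \<nu> f y\<bar> \<le> (LINT x|M. \<bar>H_kernel lam \<mu> \<nu> x y * f' x\<bar>)"
      unfolding H_op_eq f'_def[symmetric] by (rule integral_abs_bound)
    also have "\<dots> = (LINT x|M. H_kernel lam \<mu> \<nu> x y * \<bar>f' x\<bar>)"
      by (simp add: abs_mult H_kernel_nonneg)
    finally have "\<bar>H_op M lam \<mu> \<nu> f y\<bar> powr q \<le> (LINT x|M. H_kernel lam \<mu> \<nu> x y * \<bar>f' x\<bar>) powr q"
      using q_ge_1 by (intro powr_mono2) auto
    also have "\<dots> \<le> ?m powr (q - 1) * (LINT x|M. \<kappa> y x * g x powr q)"
      by (rule J(2)) measurable
    finally have "\<bar>H_op M lam \<mu> \<nu> f y\<bar> powr q * padic_norm y powr \<beta>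
        \<le> ?m powr (q - 1) * (LINT x|M. \<kappa> y x * g x powr q) * padic_norm y powr \<beta>"
      by (rule mult_right_mono) simp
    also have "\<dots> = hardy_const powr (q - 1) * (padic_norm y powr (- (\<beta> + 1) / q * (q - 1)) * padic_norm y powr \<beta>) * (LINT x|M. \<kappa> y x * g x powr q)"
      using Npos by (simp add: powr_mult powr_powr)
    also have "padic_norm y powr (- (\<beta> + 1) / q * (q - 1)) * padic_norm y powr \<beta> = padic_norm y powr b"
      unfolding powr_add[symmetric] b_def
      by (rule arg_cong[where f = "(powr) (padic_norm y)"]) (use q_ge_1 in \<open>simp add: field_simps\<close>)
    finally have "ennreal (\<bar>H_op M lam \<mu> \<nu> f y\<bar> powr q * padic_norm y powr \<beta>)
        \<le> ennreal (hardy_const powr (q - 1) * padic_norm y powr b * (LINT x|M. \<kappa> y x * g x powr q))"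
      by (rule ennreal_leI)
    also have "\<dots> = ennreal (hardy_const powr (q - 1)) * (ennreal (padic_norm y powr b) * \<Phi> y)"
      unfolding \<Phi> using \<kappa>0 by (simp add: ennreal_mult mult.assoc Bochner_Integration.integral_nonneg)
    finally show ?thesis
      using 1 by simp
  qed

  have "AE y in M. ennreal (padic_norm y powr b) * \<Phi> y * indicator (- {0}) y \<noteq> \<infinity>"
    using swap by (intro nn_integral_noteq_infinite) auto
  then have AE: "AE y in M. y \<noteq> 0 \<longrightarrow> \<Phi> y \<noteq> \<infinity>"
  proof eventually_elim
    case (elim y)
    then show ?case
      using padic_norm_pos[of y] by (auto simp: ennreal_mult_eq_top_iff)
  qed
  then show "AE y in M. y \<noteq> 0 \<longrightarrow> set_integrable M (- {0}) (\<lambda>x. H_kernel lam \<mu> \<nu> x y * f x)"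
    by eventually_elim (use pointwise in blast)

  let ?F = "\<lambda>y. \<bar>H_op M lam \<mu> \<nu> f y\<bar> powr q * padic_norm y powr \<beta>"
  have [measurable]: "H_op M lam \<mu> \<nu> f \<in> borel_measurable M"
    by (rule measurable_H_op[OF fm])
  have "(\<integral>\<^sup>+y. ennreal (indicator (- {0}) y *\<^sub>R ?F y) \<partial>M)
      \<le> (\<integral>\<^sup>+y. ennreal (hardy_const powr (q - 1)) * (ennreal (padic_norm y powr b) * \<Phi> y * indicator (- {0}) y) \<partial>M)"
    by (rule nn_integral_mono_AE, use AE in eventually_elim)
       (use pointwise in \<open>auto simp: indicator_def\<close>)
  also have "\<dots> = ennreal (hardy_const powr (q - 1)) * ennreal (hardy_const * I)"
    by (subst nn_integral_cmult) (auto simp: swap)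
  also have "\<dots> = ennreal (hardy_const powr q * I)"
    using Npos I0 by (simp add: ennreal_mult[symmetric] powr_diff)
  finally have le: "(\<integral>\<^sup>+y. ennreal (indicator (- {0}) y *\<^sub>R ?F y) \<partial>M) \<le> ennreal (hardy_const powr q * I)" .
  have lt: "(\<integral>\<^sup>+y. ennreal (indicator (- {0}) y *\<^sub>R ?F y) \<partial>M) < \<infinity>"
    by (rule le_less_trans[OF le]) simp
  have int: "set_integrable M (- {0}) ?F"
    unfolding set_integrable_def
    by (rule integrableI_nonneg[OF _ _ lt]) auto
  then show "H_op M lam \<mu> \<nu> f \<in> Lq_space M q \<beta>"
    by (simp add: Lq_space_def set_borel_measurable_def)
  have "ennreal (LINT y:- {0}|M. ?F y) \<le> ennreal (hardy_const powr q * I)"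
    using le unfolding set_lebesgue_integral_def
    by (subst nn_integral_eq_integral[symmetric]) (use int in \<open>auto simp: set_integrable_def\<close>)
  then have "(LINT y:- {0}|M. ?F y) \<le> hardy_const powr q * I"
    using I0 by (subst (asm) ennreal_le_iff) auto
  moreover have "0 \<le> (LINT y:- {0}|M. ?F y)"
    unfolding set_lebesgue_integral_def by (intro Bochner_Integration.integral_nonneg) simp
  ultimately have "(LINT y:- {0}|M. ?F y) powr (1 / q) \<le> (hardy_const powr q * I) powr (1 / q)"
    using q_ge_1 by (intro powr_mono2) auto
  also have "\<dots> = hardy_const * I powr (1 / q)"
    using Npos I0 q_ge_1 by (simp add: powr_mult powr_powr)
  finally show "Lq_norm M q \<beta> (H_op M lam \<mu> \<nu> f) \<le> hardy_const * Lq_norm M q \<alpha> f"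
    by (simp add: Lq_norm_def I_def)
qed

section \<open>Test functions\<close>

definition test_fun :: "int set \<Rightarrow> 'p padic \<Rightarrow> real" where
  "test_fun I x = (if \<exists>k\<in>I. x \<in> padic_sphere k then w x else 0)"

lemma test_fun_sphere: "x \<in> padic_sphere k \<Longrightarrow> test_fun I x = indicator I k * w x"
  using sphere_unique[of x k] by (auto simp: test_fun_def indicator_def)

lemma test_fun_nonneg: "0 \<le> test_fun I x"
  by (simp add: test_fun_def)

lemma measurable_test_fun:
  assumes "finite I"
  shows "test_fun I \<in> borel_measurable M"
proof -
  have "(\<Union>k\<in>I. padic_sphere k) \<in> sets M"
    using assms by (intro sets.finite_UN) auto
  then have "(\<lambda>x. indicator (\<Union>k\<in>I. padic_sphere k) x * w x) \<in> borel_measurable M"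
    by measurable
  moreover have "test_fun I x = indicator (\<Union>k\<in>I. padic_sphere k) x * w x" for x
    by (simp add: test_fun_def indicator_def)
  ultimately show ?thesis
    by (simp cong: measurable_cong)
qed

text \<open>The \<open>q\<close>-th power of \<open>w\<close> times the weight is
  \<open>1 / |x|\<close>, whose integral over every sphere is \<open>1 - 1 / p\<close>.\<close>

lemma test_fun_integral:
  assumes "finite I"
  shows "set_integrable M (- {0}) (\<lambda>x. \<bar>test_fun I x\<bar> powr q * padic_norm x powr \<alpha>)"
    and "(LINT x:- {0}|M. \<bar>test_fun I x\<bar> powr q * padic_norm x powr \<alpha>) = (1 - 1 / real p) * card I"
proof -
  let ?u = "\<lambda>x. \<bar>test_fun I x\<bar> powr q * padic_norm x powr \<alpha>"
  have "?u x * real p powr k = 1 * (indicator I k * 1)" if x: "x \<in> padic_sphere k" for x k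
  proof -
    have "w x powr q * padic_norm x powr \<alpha> * real p powr k = real p powr 0"
      unfolding padic_norm_sphere[OF x] powr_powr powr_add[symmetric]
      by (rule arg_cong[where f = "(powr) (real p)"]) (use q_ge_1 in \<open>simp add: field_simps\<close>)
    then show ?thesis
      using p_gt_1 q_ge_1 by (simp add: test_fun_sphere[OF x] indicator_def)
  qed
  then have "(\<integral>\<^sup>+x\<in>-{0}. ennreal (?u x) \<partial>M) =
      ennreal 1 * (ennreal (1 - 1 / real p) * (\<integral>\<^sup>+k. ennreal (indicator I k * 1) \<partial>count_space UNIV))"
    by (intro radial_nn_integral_real) auto
  also have "\<dots> = ennreal ((1 - 1 / real p) * card I)"
    using one_minus_inverse_p_pos by (subst nn_integral_indicator_count_space[OF assms]) (auto simp: ennreal_mult)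
  finally have eq: "(\<integral>\<^sup>+x\<in>-{0}. ennreal (?u x) \<partial>M) = ennreal ((1 - 1 / real p) * card I)" .
  have [measurable]: "test_fun I \<in> borel_measurable M"
    by (rule measurable_test_fun[OF assms])
  have "?u \<in> borel_measurable M"
    by measurable
  from set_integral_of_nn_integral[OF this _ _ eq] one_minus_inverse_p_pos
  show "set_integrable M (- {0}) ?u" "(LINT x:- {0}|M. ?u x) = (1 - 1 / real p) * card I"
    by simp_all
qed

lemma test_fun_Lq: "finite I \<Longrightarrow> test_fun I \<in> Lq_space M q \<alpha>"
proof -
  assume I: "finite I"
  have [measurable]: "- {0} \<in> sets M"
    using borel_closed[of "{0 :: 'p padic}"] sets_M by auto
  have [measurable]: "test_fun I \<in> borel_measurable M"
    by (rule measurable_test_fun[OF I])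
  show ?thesis
    using test_fun_integral(1)[OF I] by (simp add: Lq_space_def set_borel_measurable_def)
qed

lemma Lq_norm_test_fun:
  "finite I \<Longrightarrow> Lq_norm M q \<alpha> (test_fun I) = ((1 - 1 / real p) * card I) powr (1 / q)"
  by (simp add: Lq_norm_def test_fun_integral)

lemma H_op_test_fun:
  assumes I: "finite I" and y: "y \<in> padic_sphere j"
  shows "H_op M lam \<mu> \<nu> (test_fun I) y =
    padic_norm y powr (- (\<beta> + 1) / q) * ((1 - 1 / real p) * (\<Sum>k\<in>I. G k j))"
proof -
  let ?u = "\<lambda>x. H_kernel lam \<mu> \<nu> x y * test_fun I x" and ?a = "padic_norm y powr (- (\<beta> + 1) / q)"
  have "?u x * real p powr k = ?a * (indicator I k * G k j)" if x: "x \<in> padic_sphere k" for x k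
    using kernel_sphere_w[OF x y] by (simp add: test_fun_sphere[OF x] ac_simps)
  then have "(\<integral>\<^sup>+x\<in>-{0}. ennreal (?u x) \<partial>M) =
      ennreal ?a * (ennreal (1 - 1 / real p) * (\<integral>\<^sup>+k. ennreal (indicator I k * G k j) \<partial>count_space UNIV))"
    by (intro radial_nn_integral_real) (auto simp: G_pos less_imp_le)
  also have "\<dots> = ennreal (?a * ((1 - 1 / real p) * (\<Sum>k\<in>I. G k j)))"
    using one_minus_inverse_p_pos by (subst nn_integral_indicator_count_space[OF I])
      (auto simp: ennreal_mult G_pos less_imp_le sum_nonneg)
  finally have eq: "(\<integral>\<^sup>+x\<in>-{0}. ennreal (?u x) \<partial>M) = ennreal (?a * ((1 - 1 / real p) * (\<Sum>k\<in>I. G k j)))" .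
  have [measurable]: "test_fun I \<in> borel_measurable M"
    by (rule measurable_test_fun[OF I])
  have "?u \<in> borel_measurable M"
    unfolding H_kernel_def by measurable
  from set_integral_of_nn_integral(2)[OF this _ _ eq] one_minus_inverse_p_pos show ?thesis
    unfolding H_op_def
    by (simp add: H_kernel_nonneg test_fun_nonneg sum_nonneg G_pos less_imp_le)
qed

text \<open>The norm inequality becomes one in \<open>l^q\<close> over the integers: the weights
  cancel the sphere measures and a common factor \<open>1 - 1 / p\<close> drops out. Restricting to
  a finite \<open>J\<close> only lowers the left side.\<close>

lemma test_fun_bound:
  assumes I: "finite I" and J: "finite J" and C: "0 \<le> C"
    and mem: "H_op M lam \<mu> \<nu> (test_fun I) \<in> Lq_space M q \<beta>"
    and le: "Lq_norm M q \<beta> (H_op M lam \<mu> \<nu> (test_fun I)) \<le> C * Lq_norm M q \<alpha> (test_fun I)"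
  shows "(\<Sum>j\<in>J. ((1 - 1 / real p) * (\<Sum>k\<in>I. G k j)) powr q) \<le> C powr q * card I"
proof -
  let ?c = "1 - 1 / real p"
  let ?u = "\<lambda>y. \<bar>H_op M lam \<mu> \<nu> (test_fun I) y\<bar> powr q * padic_norm y powr \<beta>"
  define s where "s j = ?c * (\<Sum>k\<in>I. G k j)" for j
  have s0: "0 \<le> s j" for j
    using one_minus_inverse_p_pos by (simp add: s_def sum_nonneg G_pos less_imp_le)
  have u: "?u y * real p powr j = 1 * s j powr q" if y: "y \<in> padic_sphere j" for y j
  proof -
    have "(padic_norm y powr (- (\<beta> + 1) / q)) powr q * padic_norm y powr \<beta> * real p powr j = real p powr 0"
      unfolding padic_norm_sphere[OF y] powr_powr powr_add[symmetric]
      by (rule arg_cong[where f = "(powr) (real p)"]) (use q_ge_1 in \<open>simp add: field_simps\<close>)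
    moreover have "?u y * real p powr j =
        ((padic_norm y powr (- (\<beta> + 1) / q)) powr q * padic_norm y powr \<beta> * real p powr j) * s j powr q"
      unfolding H_op_test_fun[OF I y] s_def[symmetric]
      using s0[of j] by (simp add: abs_mult powr_mult ac_simps)
    ultimately show ?thesis
      using p_gt_1 by simp
  qed
  have radial: "(\<integral>\<^sup>+y\<in>-{0}. ennreal (?u y) \<partial>M) =
      ennreal 1 * (ennreal ?c * (\<integral>\<^sup>+j. ennreal (s j powr q) \<partial>count_space UNIV))"
    by (intro radial_nn_integral_real u) auto
  have int: "set_integrable M (- {0}) ?u"
    using mem by (simp add: Lq_space_def)
  let ?R = "LINT y:- {0}|M. ?u y"
  have R0: "0 \<le> ?R"
    unfolding set_lebesgue_integral_def by (intro Bochner_Integration.integral_nonneg) simp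
  \<comment> \<open>Membership in \<open>Lq_space\<close> enters here: for a non-integrable function
    the Bochner integral would be \<open>0\<close> and the norm bound void.\<close>
  have R: "(\<integral>\<^sup>+y\<in>-{0}. ennreal (?u y) \<partial>M) = ennreal ?R"
  proof -
    have "(\<integral>\<^sup>+y. ennreal (indicator (- {0}) y *\<^sub>R ?u y) \<partial>M) = ennreal ?R"
      unfolding set_lebesgue_integral_def
      using int by (intro nn_integral_eq_integral) (auto simp: set_integrable_def)
    moreover have "(\<integral>\<^sup>+y\<in>-{0}. ennreal (?u y) \<partial>M) = (\<integral>\<^sup>+y. ennreal (indicator (- {0}) y *\<^sub>R ?u y) \<partial>M)"
      by (intro nn_integral_cong) (simp add: indicator_def)
    ultimately show ?thesis by simp
  qed
  have "ennreal (?c * (\<Sum>j\<in>J. s j powr q)) =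
      ennreal ?c * (\<integral>\<^sup>+j. ennreal (indicator J j * s j powr q) \<partial>count_space UNIV)"
    using one_minus_inverse_p_pos by (subst nn_integral_indicator_count_space[OF J]) (auto simp: ennreal_mult sum_nonneg)
  also have "\<dots> \<le> ennreal ?c * (\<integral>\<^sup>+j. ennreal (s j powr q) \<partial>count_space UNIV)"
    by (intro mult_left_mono nn_integral_mono) (auto simp: indicator_def)
  also have "\<dots> = ennreal ?R"
    using radial R by simp
  finally have 1: "?c * (\<Sum>j\<in>J. s j powr q) \<le> ?R"
    using R0 by simp
  have "?R = (?R powr (1 / q)) powr q"
    using R0 q_ge_1 by (simp add: powr_powr)
  also have "\<dots> \<le> (C * (?c * card I) powr (1 / q)) powr q"
    using le R0 q_ge_1 unfolding Lq_norm_test_fun[OF I]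
    by (intro powr_mono2) (auto simp: Lq_norm_def)
  also have "\<dots> = C powr q * (?c * card I)"
    using C one_minus_inverse_p_pos q_ge_1 by (simp add: powr_mult powr_powr)
  finally have "?c * (\<Sum>j\<in>J. s j powr q) \<le> ?c * (C powr q * card I)"
    using 1 by (simp add: ac_simps)
  then show ?thesis
    using one_minus_inverse_p_pos by (simp only: s_def mult_le_cancel_left_pos)
qed

section \<open>Characterisation and norm\<close>

lemma Lq_norm_nonneg: "0 \<le> Lq_norm M q \<theta> f"
  by (simp add: Lq_norm_def)

lemma H_bounded_imp:
  assumes "H_bounded M lam \<mu> \<nu> q \<alpha> \<beta>"
  shows "lam = A + B \<and> 0 < A \<and> 0 < B"
proof -
  let ?c = "1 - 1 / real p"
  obtain C0 where C0: "\<And>f. f \<in> Lq_space M q \<alpha> \<Longrightarrow> H_op M lam \<mu> \<nu> f \<in> Lq_space M q \<beta> \<and>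
      Lq_norm M q \<beta> (H_op M lam \<mu> \<nu> f) \<le> C0 * Lq_norm M q \<alpha> f"
    using assms unfolding H_bounded_def by blast
  define C where "C = \<bar>C0\<bar>"
  have C: "Lq_norm M q \<beta> (H_op M lam \<mu> \<nu> f) \<le> C * Lq_norm M q \<alpha> f" if "f \<in> Lq_space M q \<alpha>" for f
    using C0[OF that] mult_right_mono[of C0 C "Lq_norm M q \<alpha> f"] Lq_norm_nonneg by (fastforce simp: C_def)
  \<comment> \<open>Testing on the single sphere \<open>m\<close> bounds the \<open>q\<close>-sum of
    row \<open>m\<close> of \<open>G\<close>, uniformly in \<open>m\<close>.\<close>
  have E: "(\<Sum>j\<in>J. (?c * G m j) powr q) \<le> C powr q" if "finite J" for m J
    using test_fun_bound[of "{m}" J C] C[OF test_fun_Lq] C0[OF test_fun_Lq] that by (simp add: C_def)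
  \<comment> \<open>Infinitely many entries at least 1 in row \<open>0\<close> would make its
    \<open>q\<close>-sum diverge.\<close>
  have bounded_card: False
    if "inj h" and "\<And>n::nat. 1 \<le> G 0 (h n)" for h
  proof -
    obtain n :: nat where n: "C powr q < n * ?c powr q"
      using ex_less_of_nat_mult[of "?c powr q" "C powr q"] p_gt_1 by auto
    have "n * ?c powr q = (\<Sum>j\<in>h ` {..<n}. ?c powr q)"
      using that(1) by (simp add: card_image inj_on_subset)
    also have "\<dots> \<le> (\<Sum>j\<in>h ` {..<n}. (?c * G 0 j) powr q)"
      using one_minus_inverse_p_pos q_ge_1 that(2) by (intro sum_mono powr_mono2) auto
    also have "\<dots> \<le> C powr q"
      by (rule E) simp
    finally show False
      using n by simp
  qed
  have hom: "lam = A + B"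
  proof (rule ccontr)
    assume ne: "lam \<noteq> A + B"
    define d where "d = A + B - lam"
    have "1 < real p powr \<bar>d\<bar>"
      using ne p_gt_1 by (simp add: d_def)
    then obtain n where n: "C / ?c < (real p powr \<bar>d\<bar>) ^ n"
      using real_arch_pow by blast
    \<comment> \<open>The sign makes \<open>m * d = n * \<bar>d\<bar>\<close>, so the diagonal entry
      \<open>p powr (m * d)\<close> is large.\<close>
    define m where "m = (if 0 \<le> d then int n else - int n)"
    have "G m m = real p powr (\<bar>d\<bar> * n)"
      by (simp add: G_def m_def d_def abs_if algebra_simps)
    also have "\<dots> = (real p powr \<bar>d\<bar>) ^ n"
      using p_gt_1 by (simp add: powr_realpow[symmetric] powr_powr)
    finally have "C < ?c * G m m"
      using n one_minus_inverse_p_pos by (simp add: pos_divide_less_eq mult.commute)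
    then have "C powr q < (?c * G m m) powr q"
      using q_ge_1 by (intro powr_less_mono2) (auto simp: C_def)
    with E[of "{m}" m] show False
      by simp
  qed
  \<comment> \<open>For negative columns the maximum is \<open>0\<close> and
    \<open>G 0 (- n)\<close> is \<open>p powr (- n * B)\<close>, at least 1 if
    \<open>B \<le> 0\<close>.\<close>
  moreover have "0 < B"
  proof (rule ccontr)
    assume "\<not> 0 < B"
    then show False
      using p_gt_1 by (intro bounded_card[of "\<lambda>n. - int n"])
        (auto simp: inj_def G_def mult_le_0_iff intro!: ge_one_powr_ge_zero)
  qed
  moreover have "0 < A"
  proof (rule ccontr)
    assume "\<not> 0 < A"
    \<comment> \<open>For positive columns the maximum is \<open>n\<close>, and \<open>hom\<close>
      turns the exponent \<open>n * (B - lam)\<close> into \<open>- n * A\<close>.\<close>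
    moreover have "G 0 (int n) = real p powr (- (n * A))" for n
      unfolding G_def by (rule arg_cong[where f = "(powr) (real p)"]) (simp add: hom algebra_simps)
    ultimately show False
      using p_gt_1 by (intro bounded_card[of int])
        (auto simp: mult_le_0_iff intro!: ge_one_powr_ge_zero)
  qed
  ultimately show ?thesis by blast
qed

lemma H_bounded_iff: "H_bounded M lam \<mu> \<nu> q \<alpha> \<beta> \<longleftrightarrow> lam = A + B \<and> 0 < A \<and> 0 < B"
  using H_bounded_imp schur_test unfolding H_bounded_def by blast

text \<open>With \<open>n\<close> consecutive spheres, all but \<open>2 L\<close> of the
  \<open>n\<close> columns contain the full window of \<open>2 L + 1\<close> central diagonals. The
  edge loss vanishes relative to \<open>n\<close>, and the windows exhaust the sum.\<close>

lemma hardy_const_le_of_test_fun_bound: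
  assumes hom: "lam = A + B" "0 < A" "0 < B" and C: "0 \<le> C"
    and bound: "\<And>I. finite I \<Longrightarrow> I \<noteq> {} \<Longrightarrow>
      Lq_norm M q \<beta> (H_op M lam \<mu> \<nu> (test_fun I)) \<le> C * Lq_norm M q \<alpha> (test_fun I)"
  shows "hardy_const \<le> C"
proof -
  let ?c = "1 - 1 / real p"
  have partial: "?c * (\<Sum>m\<in>{- int L..int L}. G m 0) \<le> C" for L
  proof -
    define s where "s = ?c * (\<Sum>m\<in>{- int L..int L}. G m 0)"
    have s0: "0 \<le> s"
      using one_minus_inverse_p_pos by (simp add: s_def sum_nonneg G_pos less_imp_le)
    have "(1 - 2 * real L / real n) * s powr q \<le> C powr q" if n: "n > 2 * L" for n
    proof -
      \<comment> \<open>For \<open>j\<close> in \<open>?J\<close> the interval from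
        \<open>j - L\<close> to \<open>j + L\<close> lies in \<open>?I\<close>; \<open>?J\<close>
        has \<open>n - 2 L\<close> elements.\<close>
      let ?I = "{1..int n}" and ?J = "{int L + 1..int n - int L}"
      have "s \<le> ?c * (\<Sum>k\<in>?I. G k j)" if j: "j \<in> ?J" for j
      proof -
        \<comment> \<open>A convolution is constant along diagonals, so the window moves from column
          \<open>0\<close> to column \<open>j\<close>.\<close>
        have "(\<Sum>m\<in>{- int L..int L}. G m 0) = (\<Sum>m\<in>{- int L..int L}. G (m + j) j)"
          by (simp only: G_eq_convolution[OF hom(1)] diff_0_right add_diff_cancel_right')
        also have "\<dots> = (\<Sum>k\<in>(\<lambda>m. m + j) ` {- int L..int L}. G k j)"
          by (subst sum.reindex) (auto simp: inj_on_def)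
        also have "\<dots> \<le> (\<Sum>k\<in>?I. G k j)"
          using j by (intro sum_mono2) (auto simp: G_pos less_imp_le)
        finally show ?thesis
          unfolding s_def using one_minus_inverse_p_pos by (intro mult_left_mono) auto
      qed
      then have "(\<Sum>j\<in>?J. s powr q) \<le> (\<Sum>j\<in>?J. (?c * (\<Sum>k\<in>?I. G k j)) powr q)"
        using s0 q_ge_1 by (intro sum_mono powr_mono2) auto
      also have "\<dots> \<le> C powr q * card ?I"
        using n by (intro test_fun_bound C schur_test(2)[OF hom] test_fun_Lq bound) auto
      finally have "(real n - 2 * real L) * s powr q \<le> C powr q * real n"
        using n by (simp add: of_nat_diff)
      then show ?thesis
        using n by (simp add: field_simps)
    qed
    then have "eventually (\<lambda>n. (1 - 2 * real L / real n) * s powr q \<le> C powr q) sequentially"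
      by (rule eventually_mono[OF eventually_gt_at_top])
    moreover have "(\<lambda>n. (1 - 2 * real L / real n) * s powr q) \<longlonglongrightarrow> (1 - 0) * s powr q"
      by (intro tendsto_intros lim_const_over_n)
    ultimately have "(1 - 0) * s powr q \<le> C powr q"
      by (intro tendsto_upperbound) auto
    then have "s powr q \<le> C powr q"
      by simp
    then have "s \<le> C"
      using powr_less_mono2[of q C s] q_ge_1 C by (meson linorder_not_le less_le_trans zero_less_one)
    then show ?thesis
      by (simp add: s_def)
  qed
  \<comment> \<open>Now \<open>L\<close> tends to infinity, by monotone convergence of the truncated
    column sums.\<close>
  have "ennreal hardy_const = ennreal ?c * (\<integral>\<^sup>+m. ennreal (G m 0) \<partial>count_space UNIV)"
    using G_sums(1)[OF hom] by simp
  also have "(\<integral>\<^sup>+m. ennreal (G m 0) \<partial>count_space UNIV) =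
      (\<integral>\<^sup>+m. (SUP L::nat. ennreal (indicator {- int L..int L} m * G m 0)) \<partial>count_space UNIV)"
  proof (intro nn_integral_cong antisym SUP_least)
    show "ennreal (G m 0) \<le> (SUP L::nat. ennreal (indicator {- int L..int L} m * G m 0))" for m
      by (rule SUP_upper2[of "nat \<bar>m\<bar>"]) (auto simp: indicator_def)
    show "ennreal (indicator {- int L..int L} m * G m 0) \<le> ennreal (G m 0)" for L m
      using G_pos[of m 0] by (auto simp: indicator_def)
  qed
  also have "\<dots> = (SUP L::nat. \<integral>\<^sup>+m. ennreal (indicator {- int L..int L} m * G m 0) \<partial>count_space UNIV)"
    by (rule nn_integral_monotone_convergence_SUP)
       (auto simp: incseq_def le_fun_def indicator_def G_pos less_imp_le intro!: ennreal_leI)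
  also have "ennreal ?c * \<dots> = (SUP L::nat. ennreal ?c * (\<integral>\<^sup>+m. ennreal (indicator {- int L..int L} m * G m 0) \<partial>count_space UNIV))"
    by (simp add: SUP_mult_left_ennreal)
  also have "\<dots> \<le> ennreal C"
  proof (rule SUP_least)
    show "ennreal ?c * (\<integral>\<^sup>+m. ennreal (indicator {- int L..int L} m * G m 0) \<partial>count_space UNIV) \<le> ennreal C" for L :: nat
      using one_minus_inverse_p_pos partial[of L]
      by (subst nn_integral_indicator_count_space)
         (auto simp: G_pos less_imp_le ennreal_mult'[symmetric] intro!: ennreal_leI)
  qed
  finally show ?thesis
    using C by simp
qed

lemma H_opnorm_eq:
  assumes hom: "lam = A + B" "0 < A" "0 < B"
  shows "H_opnorm M lam \<mu> \<nu> q \<alpha> \<beta> = hardy_const"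
proof -
  let ?X = "{f \<in> Lq_space M q \<alpha>. \<not> (AE x in M. x \<noteq> 0 \<longrightarrow> f x = 0)}"
  let ?r = "\<lambda>f. Lq_norm M q \<beta> (H_op M lam \<mu> \<nu> f) / Lq_norm M q \<alpha> f"
  \<comment> \<open>A quotient with zero denominator is \<open>0\<close>, which lies below the
    positive constant.\<close>
  have le: "?r f \<le> hardy_const" if "f \<in> Lq_space M q \<alpha>" for f
    using schur_test(3)[OF hom that] Lq_norm_nonneg[of \<alpha> f] hardy_const_pos[OF hom(2,3)]
    by (cases "Lq_norm M q \<alpha> f = 0") (simp_all add: pos_divide_le_eq)
  have norm_pos: "0 < Lq_norm M q \<alpha> (test_fun I)" if "finite I" "I \<noteq> {}" for I
    using that p_gt_1 by (simp add: Lq_norm_test_fun card_gt_0_iff)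
  have test: "test_fun I \<in> ?X" if "finite I" "I \<noteq> {}" for I
  proof -
    have "\<not> (AE x in M. x \<noteq> 0 \<longrightarrow> test_fun I x = 0)"
    proof
      assume "AE x in M. x \<noteq> 0 \<longrightarrow> test_fun I x = 0"
      then have "(LINT x:- {0}|M. \<bar>test_fun I x\<bar> powr q * padic_norm x powr \<alpha>) = 0"
        unfolding set_lebesgue_integral_def
        by (intro integral_eq_zero_AE) (auto elim!: eventually_mono simp: indicator_def)
      with norm_pos[OF that] show False
        by (simp add: Lq_norm_def)
    qed
    with test_fun_Lq[OF that(1)] show ?thesis by simp
  qed
  \<comment> \<open>Boundedness makes the real \<open>SUP\<close> an actual upper bound of the
    quotients.\<close>
  have bdd: "bdd_above (?r ` ?X)"
    using le by (intro bdd_aboveI[of _ hardy_const]) auto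
  show ?thesis
  proof (rule antisym)
    show "H_opnorm M lam \<mu> \<nu> q \<alpha> \<beta> \<le> hardy_const"
      unfolding H_opnorm_def using test[of "{0}"] le by (intro cSUP_least) auto
    have upper: "?r (test_fun I) \<le> H_opnorm M lam \<mu> \<nu> q \<alpha> \<beta>" if "finite I" "I \<noteq> {}" for I
      unfolding H_opnorm_def by (rule cSUP_upper[OF test[OF that] bdd])
    show "hardy_const \<le> H_opnorm M lam \<mu> \<nu> q \<alpha> \<beta>"
    proof (rule hardy_const_le_of_test_fun_bound[OF hom])
      have "0 \<le> ?r (test_fun {0})"
        using Lq_norm_nonneg by simp
      with upper[of "{0}"] show "0 \<le> H_opnorm M lam \<mu> \<nu> q \<alpha> \<beta>"
        by simp
      show "Lq_norm M q \<beta> (H_op M lam \<mu> \<nu> (test_fun I)) \<le> H_opnorm M lam \<mu> \<nu> q \<alpha> \<beta> * Lq_norm M q \<alpha> (test_fun I)"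
        if "finite I" "I \<noteq> {}" for I
        using upper[OF that] norm_pos[OF that] by (simp add: pos_divide_le_eq)
    qed
  qed
qed

end

theorem theorem1p6:
  fixes M :: "'p::prime_card padic measure"
    and p :: nat
    and q lam \<mu> \<nu> \<alpha> \<beta> :: real
  assumes "p = CARD('p)"
    and "normalized_padic_haar M"
    and "1 \<le> q"
  shows "(H_bounded M lam \<mu> \<nu> q \<alpha> \<beta> \<longleftrightarrow>
            lam = \<mu> + \<nu> + 1 + (\<beta> - \<alpha>) / q \<and> - q * \<nu> < \<beta> + 1 \<and> \<beta> + 1 < q * (lam - \<nu>)) \<and>
         (H_bounded M lam \<mu> \<nu> q \<alpha> \<beta> \<longleftrightarrow>
            lam = \<mu> + \<nu> + 1 + (\<beta> - \<alpha>) / q \<and> q * (\<mu> + 1 - lam) < \<alpha> + 1 \<and> \<alpha> + 1 < q * (\<mu> + 1)) \<and>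
         (H_bounded M lam \<mu> \<nu> q \<alpha> \<beta> \<longrightarrow>
            H_opnorm M lam \<mu> \<nu> q \<alpha> \<beta> =
              (1 - 1 / real p) * (1 + 1 / (real p powr (\<mu> + 1 - (\<alpha> + 1) / q) - 1)
                                    + 1 / (real p powr (\<nu> + (\<beta> + 1) / q) - 1)))"
proof -
  interpret padic_hardy M p q lam \<mu> \<nu> \<alpha> \<beta>
    using assms by unfold_locales
  have q: "q > 0"
    using assms(3) by simp
  have hom: "lam = \<mu> + \<nu> + 1 + (\<beta> - \<alpha>) / q \<longleftrightarrow> lam = A + B"
    by (simp add: A_def B_def diff_divide_distrib add_divide_distrib algebra_simps)
  have B: "- q * \<nu> < \<beta> + 1 \<longleftrightarrow> 0 < B"
    using q by (simp add: B_def field_simps) linarith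
  have A: "\<alpha> + 1 < q * (\<mu> + 1) \<longleftrightarrow> 0 < A"
    using q by (simp add: A_def field_simps)
  \<comment> \<open>Under \<open>lam = A + B\<close>, \<open>B < lam\<close> means
    \<open>0 < A\<close> and \<open>A < lam\<close> means \<open>0 < B\<close>, so both pairs of
    inequalities say the same.\<close>
  have B': "\<beta> + 1 < q * (lam - \<nu>) \<longleftrightarrow> B < lam" and A': "q * (\<mu> + 1 - lam) < \<alpha> + 1 \<longleftrightarrow> A < lam"
    using q by (simp_all add: A_def B_def field_simps)
  show ?thesis
    unfolding hom A B A' B' H_bounded_iff A_def[symmetric] B_def[symmetric] hardy_const_def[symmetric]
    using H_opnorm_eq by auto
qed

end
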